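(* Let $k \geq 3$ and let $A = \{a_1, a_2, \ldots, a_k\}$ be a set of $k$ positive integers with $a_1 < a_2 < \cdots < a_k$ and $d(A) = 1$. Let $\alpha \leq k-2$ be a positive integer. Then \[ |S_\alpha(A)| \geq \begin{cases} a_k + \dfrac{k(k-1)}{2} - \dfrac{\alpha(\alpha+1)}{2} + 1 & \text{if } a_k \leq 2k-3,\\[2mm] \theta(k+1) - 4 + \dfrac{k(k-1)}{2} - \dfrac{\alpha(\alpha+1)}{2} + 1 & \text{if } a_k \geq 2k-2. \end{cases} \]
   Context: For a finite set $A$ of integers and a positive integer $\alpha$, $S_\alpha(A) = \{\sum_{b\in B} b : B \subseteq A, |B| \geq \alpha\}$. $d(A)$ is the greatest common divisor of the elements of $A$. $\theta = \frac{1+\sqrt5}{2}$. *)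

theory Defs
  imports Complex_Main
begin

definition subset_sums_ge :: "nat \<Rightarrow> int set \<Rightarrow> int set" where
  "subset_sums_ge \<alpha> A = {\<Sum>B | B. B \<subseteq> A \<and> \<alpha> \<le> card B}"

definition golden_ratio :: real where
  "golden_ratio = (1 + sqrt 5) / 2"

end

theory Submission
  imports Defs
begin

text \<open>
  Put \<open>X = A \<union> {0}\<close> and \<open>l = a k\<close>, and let \<open>Y\<close> be the set of sums of two distinct elements of \<open>X\<close>.
  Complements of sets with at most two elements give \<open>|S\<^sub>k\<^sub>-\<^sub>2(A)| \<ge> |Y| + 1\<close>, and deleting one element
  from the subset of least sum gives \<open>|S\<^sub>r(A)| \<ge> |S\<^sub>r\<^sub>+\<^sub>1(A)| + r + 1\<close>, so it suffices to bound \<open>|Y|\<close>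
  from below (a theorem of Lev). Every \<open>x \<in> X\<close> with \<open>0 < x < l\<close> yields the two sums \<open>x\<close> and \<open>x + l\<close> of \<open>Y\<close> in one
  residue class, so \<open>|Y| \<ge> |Y mod l| + k - 1\<close>. If \<open>l \<le> 2 k - 3\<close>, the pigeonhole principle shows that \<open>Y\<close>
  meets every class.

  If \<open>l \<ge> 2 k - 2\<close>, let \<open>P = X mod l\<close>. When some \<open>d + d\<close> with \<open>d \<in> P\<close> is not a sum of two distinct
  elements of \<open>P\<close>, then \<open>P - d\<close> and its negative are almost disjoint, and counting representations gives
  roughly \<open>(1 + 1 / \<surd>2) k\<close> sums of distinct elements. Otherwise these sums exhaust \<open>P + P\<close>; if that set
  has fewer than \<open>\<theta> k\<close> elements, then modulo its stabilizer the doubling is just below \<open>\<theta>\<close>,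
  so \<open>P\<close> nearly fills its cosets, and the integer sums in one further coset make up for the deficit.
\<close>

subsection \<open>Sums of distinct elements with an isolated double\<close>

definition rdouble :: "'a::ab_group_add set \<Rightarrow> 'a set" where
  "rdouble C = {x + y | x y. x \<in> C \<and> y \<in> C \<and> x \<noteq> y}"

lemma rdoubleI: "x \<in> C \<Longrightarrow> y \<in> C \<Longrightarrow> x \<noteq> y \<Longrightarrow> x + y \<in> rdouble C"
  unfolding rdouble_def by blast

lemma rdouble_eq_image: "rdouble C = (\<lambda>(x, y). x + y) ` {(x, y). x \<in> C \<and> y \<in> C \<and> x \<noteq> y}"
  unfolding rdouble_def by force

lemma finite_offdiag: "finite C \<Longrightarrow> finite {(x, y). x \<in> C \<and> y \<in> C \<and> x \<noteq> y}"
  by (rule finite_subset[of _ "C \<times> C"]) auto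

lemma finite_rdouble: "finite C \<Longrightarrow> finite (rdouble C)"
  unfolding rdouble_eq_image using finite_offdiag by blast

lemma card_offdiag:
  assumes "finite C"
  shows "card {(x, y). x \<in> C \<and> y \<in> C \<and> x \<noteq> y} + card C = card C * card C"
proof -
  let ?d = "(\<lambda>x. (x, x)) ` C" and ?O = "{(x, y). x \<in> C \<and> y \<in> C \<and> x \<noteq> y}"
  have "card (?O \<union> ?d) = card ?O + card ?d"
    by (rule card_Un_disjoint) (use assms finite_offdiag in auto)
  moreover have "?O \<union> ?d = C \<times> C" by auto
  moreover have "card ?d = card C" by (rule card_image) (auto intro: inj_onI)
  ultimately show ?thesis by (simp add: card_cartesian_product)
qed

text \<open>Ordered representations of \<open>c\<close> as a sum of two distinct elements, recorded
  by the first summand, so every unordered pair counts twice.\<close>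

definition rreps :: "'a::ab_group_add set \<Rightarrow> 'a \<Rightarrow> 'a set" where
  "rreps C c = {x \<in> C. c - x \<in> C \<and> c - x \<noteq> x}"

lemma finite_rreps: "finite C \<Longrightarrow> finite (rreps C c)"
  unfolding rreps_def by simp

lemma sum_card_rreps_subset:
  fixes C :: "'a::ab_group_add set"
  assumes "finite C" "finite Q"
  shows "(\<Sum>c\<in>Q. card (rreps C c)) = card {(x, y). x \<in> C \<and> y \<in> C \<and> x \<noteq> y \<and> x + y \<in> Q}"
proof -
  have "(\<Sum>c\<in>Q. card (rreps C c)) = card (Sigma Q (rreps C))"
    using assms by (simp add: finite_rreps)
  also have "\<dots> = card {(x, y). x \<in> C \<and> y \<in> C \<and> x \<noteq> y \<and> x + y \<in> Q}"
    by (rule bij_betw_same_card[of "\<lambda>(c, x). (x, c - x)"],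
        rule bij_betw_byWitness[where f' = "\<lambda>(x, y). (x + y, x)"])
       (auto simp: rreps_def)
  finally show ?thesis .
qed

text \<open>Links the number of representations of the difference \<open>u - v\<close> to an overlap
  of translates, which inclusion-exclusion can bound.\<close>

lemma card_Int_translates:
  fixes C :: "'a::ab_group_add set"
  assumes "finite C"
  shows "card ((\<lambda>x. x + u) ` C \<inter> (\<lambda>x. x + v) ` C) = card {x \<in> C. x + v - u \<in> C}"
proof -
  have "(\<lambda>x. x + u) ` C \<inter> (\<lambda>x. x + v) ` C = (\<lambda>x. x + v) ` {x \<in> C. x + v - u \<in> C}"
  proof (intro set_eqI iffI)
    fix z assume "z \<in> (\<lambda>x. x + v) ` {x \<in> C. x + v - u \<in> C}"
    then obtain x where "x \<in> C" "x + v - u \<in> C" "z = (x + v - u) + u" "z = x + v" by auto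
    then show "z \<in> (\<lambda>x. x + u) ` C \<inter> (\<lambda>x. x + v) ` C" by blast
  next
    fix z assume "z \<in> (\<lambda>x. x + u) ` C \<inter> (\<lambda>x. x + v) ` C"
    then obtain x y where xy: "x \<in> C" "y \<in> C" "z = y + u" "z = x + v" by auto
    then have "x + v - u \<in> C" by (metis add_diff_cancel_right')
    then show "z \<in> (\<lambda>x. x + v) ` {x \<in> C. x + v - u \<in> C}" using xy(1,4) by blast
  qed
  then show ?thesis by (simp add: card_image)
qed

text \<open>A translate of a set with a double \<open>d + d\<close> that is not a sum of two distinct elements: \<open>d\<close> is moved
  to \<open>0\<close>. The parameter \<open>\<omega>\<close> is the involution contained in \<open>C\<close>, or \<open>0\<close> if there is none.\<close>

locale isolated_double =
  fixes C :: "'a::ab_group_add set" and \<omega> :: 'a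
  assumes fin: "finite C"
    and zero: "0 \<in> C"
    and om: "\<omega> \<in> C" "\<omega> + \<omega> = 0"
    and isolated: "0 \<notin> rdouble C"
    and invol: "\<And>x. x \<in> C \<Longrightarrow> x + x = 0 \<Longrightarrow> x = 0 \<or> x = \<omega>"
    and halves: "\<And>z. card {x \<in> C. x + x = z} \<le> 2"
begin

text \<open>Since \<open>0 \<in> C\<close>, the set \<open>rdouble C\<close> contains
  \<open>C - {0}\<close>, so \<open>B\<close> is the excess that has to be shown large.\<close>

abbreviation "B \<equiv> rdouble C - C"

lemma finite_B: "finite B" using fin finite_rdouble by blast

text \<open>If \<open>x\<close> and \<open>- x\<close> were different, their sum 0 would lie in
  \<open>rdouble C\<close>.\<close>

lemma neg: assumes "x \<in> C" "- x \<in> C" shows "x = 0 \<or> x = \<omega>"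
proof -
  have "x = - x" using rdoubleI[OF assms] isolated by auto
  then have "x + x = 0" by (metis add.right_inverse)
  then show ?thesis using invol assms by blast
qed

lemma rdouble_split: "rdouble C = (C - {0}) \<union> B"
  using isolated rdoubleI[OF zero] by force

lemma card_rdouble: "card (rdouble C) + 1 = card C + card B"
proof -
  have "card (rdouble C) = card (C - {0}) + card B"
    by (subst rdouble_split, rule card_Un_disjoint) (use fin finite_B in auto)
  then show ?thesis using card_Suc_Diff1[OF fin zero] by linarith
qed

text \<open>The translates of \<open>C\<close> by \<open>u\<close> and \<open>v\<close> lie in
  \<open>rdouble C\<close>, except possibly for the doubles \<open>u + u\<close> and
  \<open>v + v\<close>, so their union has at most \<open>card C + card B + 1\<close>
  elements.\<close>

lemma overlap:
  assumes "u \<in> C" "v \<in> C" "u \<noteq> v"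
  shows "card C \<le> card {x \<in> C. x + v - u \<in> C} + card B + 1"
proof -
  let ?U = "(\<lambda>x. x + u) ` C" and ?W = "(\<lambda>x. x + v) ` C"
  have "?U \<union> ?W \<subseteq> rdouble C \<union> {u + u, v + v}"
    using assms rdoubleI by blast
  then have "card (?U \<union> ?W) \<le> card (rdouble C \<union> {u + u, v + v})"
    by (intro card_mono) (use fin finite_rdouble in auto)
  also have "\<dots> \<le> card (rdouble C) + card {u + u, v + v}" by (rule card_Un_le)
  also have "\<dots> \<le> card (rdouble C) + 2" by (simp add: card_insert_if)
  finally have 1: "card (?U \<union> ?W) \<le> card (rdouble C) + 2" .
  have "card ?U + card ?W = card (?U \<union> ?W) + card (?U \<inter> ?W)"
    by (rule card_Un_Int) (use fin in auto)
  moreover have "card ?U = card C" "card ?W = card C" by (simp_all add: card_image)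
  ultimately show ?thesis using 1 card_rdouble card_Int_translates[OF fin, of u v] by linarith
qed

text \<open>Since \<open>C\<close> and \<open>- C\<close> are almost disjoint, so are \<open>c - C\<close> and \<open>c + C\<close> inside \<open>C\<close>, and the latter
  is large.\<close>

lemma rreps_le_of_difference:
  assumes c: "c \<in> B" "c = u - v" "u \<in> C" "v \<in> C"
  shows "card (rreps C c) \<le> card B + 1 + (if c - \<omega> \<in> C then 1 else 0)"
proof -
  let ?V = "{x \<in> C. x + v - u \<in> C}" and ?E = "if c - \<omega> \<in> C then {c - \<omega>} else {}"
  have "u \<noteq> v" using c zero by auto
  note ov = overlap[OF c(3,4) this]
  have "rreps C c \<inter> ?V \<subseteq> ?E"
  proof
    fix x assume x: "x \<in> rreps C c \<inter> ?V"
    then have "c - x \<in> C" "- (c - x) \<in> C" by (auto simp: rreps_def c algebra_simps)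
    then have "c - x = 0 \<or> c - x = \<omega>" by (rule neg)
    moreover have "x \<in> C" using x by auto
    ultimately show "x \<in> ?E" using c(1) by (auto simp: algebra_simps)
  qed
  then have "card (rreps C c \<inter> ?V) \<le> card ?E" by (intro card_mono) auto
  also have "\<dots> = (if c - \<omega> \<in> C then 1 else 0)" by simp
  finally have 1: "card (rreps C c \<inter> ?V) \<le> (if c - \<omega> \<in> C then 1 else 0)" .
  have "card (rreps C c) + card ?V = card (rreps C c \<union> ?V) + card (rreps C c \<inter> ?V)"
    by (rule card_Un_Int) (use fin finite_rreps in auto)
  moreover have "card (rreps C c \<union> ?V) \<le> card C"
    by (intro card_mono) (use fin in \<open>auto simp: rreps_def\<close>)
  ultimately show ?thesis using 1 ov by linarith
qed

text \<open>If \<open>c\<close> had too many representations \<open>c = (c - x) + x\<close>, some \<open>x\<close> would satisfy \<open>x + a \<in> C\<close>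
  for each \<open>a \<in> C\<close>, whence \<open>c + a = (c - x) + (x + a)\<close> and almost all of \<open>c + C\<close> would lie in \<open>B\<close>.
  The elements \<open>a\<close> in \<open>?N\<close> are those for which the two summands are forced to coincide.\<close>

lemma rreps_le_of_nondifference:
  assumes c: "c \<in> B" "\<And>u v. u \<in> C \<Longrightarrow> v \<in> C \<Longrightarrow> c \<noteq> u - v"
    and small: "3 * card B + 5 < 2 * card C"
  shows "card (rreps C c) \<le> card B + 1"
proof (rule ccontr)
  assume "\<not> ?thesis"
  then have big: "card (rreps C c) \<ge> card B + 2" by simp
  let ?R = "rreps C c"
  let ?G = "{a \<in> C. c + a \<in> rdouble C}" and ?N = "{a \<in> C. c + a \<notin> rdouble C}"
  have notC: "c + a \<notin> C" if "a \<in> C" for a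
    using c(2)[of "c + a" a] that by auto
  have "card ?G = card ((+) c ` ?G)" by (simp add: card_image)
  also have "\<dots> \<le> card B" by (intro card_mono) (use notC finite_B in auto)
  finally have G: "card ?G \<le> card B" .
  have "card C = card ?G + card ?N"
    by (subst card_Un_disjoint[symmetric]) (use fin in \<open>auto intro!: arg_cong[where f = card]\<close>)
  then have N: "card C \<le> card B + card ?N" using G by linarith
  have N0: "a \<noteq> 0" if "a \<in> ?N" for a using that c(1) by auto
  have half: "x + x = c - a" if "a \<in> ?N" "x \<in> ?R" "x + a \<in> C" for a x
  proof (rule ccontr)
    assume "x + x \<noteq> c - a"
    then have "c - x \<noteq> x + a" by (auto simp: algebra_simps)
    moreover have "c - x \<in> C" using that by (auto simp: rreps_def)
    ultimately have "(c - x) + (x + a) \<in> rdouble C" using that(3) by (intro rdoubleI)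
    then show False using that(1) by (simp add: algebra_simps)
  qed
  have meet: "card ?R \<le> card B + 1 + card (?R \<inter> {x \<in> C. x + a \<in> C})" if "a \<in> ?N" for a
  proof -
    let ?V = "{x \<in> C. x + a \<in> C}"
    have "card ?R + card ?V = card (?R \<union> ?V) + card (?R \<inter> ?V)"
      by (rule card_Un_Int) (use fin finite_rreps in auto)
    moreover have "card (?R \<union> ?V) \<le> card C"
      by (intro card_mono) (use fin in \<open>auto simp: rreps_def\<close>)
    moreover have "card C \<le> card ?V + card B + 1"
      using overlap[OF zero, of a] that N0[OF that] by auto
    ultimately show ?thesis by linarith
  qed
  \<comment> \<open>One \<open>a\<close> in \<open>?N\<close> is enough: by \<open>half\<close>, the
    elements of \<open>?R\<close> that \<open>a\<close> shifts into \<open>C\<close> are halves of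
    \<open>c - a\<close>, of which there are at most two.\<close>
  have upper: "card ?R \<le> card B + 3"
  proof -
    have "card ?N \<noteq> 0" using N small by linarith
    then have "?N \<noteq> {}" by (metis card.empty)
    then obtain a where a: "a \<in> ?N" by blast
    have "?R \<inter> {x \<in> C. x + a \<in> C} \<subseteq> {x \<in> C. x + x = c - a}" using half[OF a] by auto
    then have "card (?R \<inter> {x \<in> C. x + a \<in> C}) \<le> card {x \<in> C. x + x = c - a}"
      by (intro card_mono) (use fin in auto)
    then show ?thesis using meet[OF a] halves[of "c - a"] by linarith
  qed
  have "\<forall>a\<in>?N. \<exists>x. x \<in> ?R \<and> x + x = c - a"
  proof
    fix a assume that: "a \<in> ?N"
    have "?R \<inter> {x \<in> C. x + a \<in> C} \<noteq> {}"
    proof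
      assume "?R \<inter> {x \<in> C. x + a \<in> C} = {}"
      then have "card (?R \<inter> {x \<in> C. x + a \<in> C}) = 0" by (metis card.empty)
      then show False using meet[OF that] big by linarith
    qed
    then show "\<exists>x. x \<in> ?R \<and> x + x = c - a" using half[OF that] by blast
  qed
  from bchoice[OF this] obtain f
    where "\<forall>a\<in>?N. f a \<in> ?R \<and> f a + f a = c - a" ..
  note f = bspec[OF this, THEN conjunct1] bspec[OF this, THEN conjunct2]
  \<comment> \<open>Each half \<open>f a\<close> has the partner \<open>c - f a\<close> in
    \<open>?R\<close>, and a half equal to a partner would force \<open>a' = - a\<close>, hence
    \<open>a = \<omega>\<close>. So \<open>2 * (card ?N - 1) \<le> card ?R \<le> card B + 3\<close>,
    while \<open>card ?N \<ge> card C - card B\<close>; together these negate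
    \<open>small\<close>.\<close>
  let ?M = "?N - {\<omega>}"
  let ?P = "f ` ?M" and ?Q = "(\<lambda>a. c - f a) ` ?M"
  have injP: "inj_on f ?M"
  proof (rule inj_onI)
    fix a a' assume a: "a \<in> ?M" "a' \<in> ?M" "f a = f a'"
    have "c - a = f a + f a" by (rule f(2)[symmetric]) (use a in blast)
    also have "\<dots> = c - a'" unfolding a(3) by (rule f(2)) (use a in blast)
    finally show "a = a'" by simp
  qed
  then have injQ: "inj_on (\<lambda>a. c - f a) ?M" by (auto simp: inj_on_def)
  have "?P \<inter> ?Q = {}"
  proof (rule ccontr)
    assume "\<not> ?thesis"
    then obtain a a' where a: "a \<in> ?M" "a' \<in> ?M" "f a' = c - f a" by auto
    have "c - a' = f a' + f a'" by (rule f(2)[symmetric]) (use a in blast)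
    also have "\<dots> = c + c - (f a + f a)" unfolding a(3) by (simp add: algebra_simps)
    also have "f a + f a = c - a" by (rule f(2)) (use a in blast)
    finally have "c - a' = c + c - (c - a)" .
    then have "a' = - a" by (simp add: algebra_simps eq_neg_iff_add_eq_0)
    then have "a = 0 \<or> a = \<omega>" using neg[of a] a by auto
    then show False using a N0[of a] by auto
  qed
  then have "card ?P + card ?Q = card (?P \<union> ?Q)"
    by (subst card_Un_disjoint) (use fin in auto)
  also have "\<dots> \<le> card ?R"
  proof (intro card_mono finite_rreps fin Un_least image_subsetI)
    fix a assume "a \<in> ?M"
    then show "f a \<in> ?R" using f(1) by blast
    then show "c - f a \<in> ?R" by (auto simp: rreps_def)
  qed
  finally have "card ?M + card ?M \<le> card ?R" using injP injQ by (simp add: card_image)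
  moreover have "card ?N \<le> card ?M + 1"
    by (simp only: card_Diff_singleton_if split: if_split) arith
  ultimately show False using N upper small by linarith
qed

text \<open>For \<open>y \<noteq> z\<close> in \<open>C\<close> at most one of \<open>z - y\<close> and \<open>y - z\<close> lies in \<open>C\<close>, unless both equal \<open>\<omega>\<close>; so about
  half of all pairs have their sum in \<open>C\<close>.\<close>

lemma sum_rreps_C:
  assumes "2 \<le> card C"
  shows "2 * (\<Sum>c\<in>C - {0}. card (rreps C c)) + 4 + card C
     \<le> 2 * card C + card C * card C + card {y \<in> C. y + \<omega> \<in> C}"
proof -
  let ?O = "{(x, y). x \<in> C \<and> y \<in> C \<and> x \<noteq> y}"
  let ?Q = "{y \<in> C. y + \<omega> \<in> C}"
  let ?T = "{(y, z). y \<in> C \<and> z \<in> C \<and> y \<noteq> z \<and> z - y \<in> C}"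
  let ?Z = "{(y, z). y \<in> C \<and> z \<in> C - {0} \<and> y \<noteq> z \<and> z - y \<in> C}"
  let ?L = "{(x, y). x \<in> C \<and> y \<in> C \<and> x \<noteq> y \<and> x + y \<in> C - {0}}"
  have finT: "finite ?T" by (rule finite_subset[of _ "C \<times> C"]) (use fin in auto)
  have finZ: "finite ?Z" by (rule finite_subset[of _ "C \<times> C"]) (use fin in auto)
  \<comment> \<open>A pair with sum in \<open>C\<close> becomes a pair whose difference lies in
    \<open>C\<close>; the pairs with \<open>x = 0\<close> land on the diagonal and account for
    \<open>card C - 1\<close>.\<close>
  have "card ?L = card ((\<lambda>(x, y). (y, x + y)) ` ?L)"
    by (rule card_image[symmetric]) (auto simp: inj_on_def)
  also have "\<dots> \<le> card ((\<lambda>y. (y, y)) ` (C - {0}) \<union> ?Z)"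
    by (intro card_mono) (use finZ fin in auto)
  also have "\<dots> \<le> card ((\<lambda>y. (y, y)) ` (C - {0})) + card ?Z" by (rule card_Un_le)
  also have "card ((\<lambda>y. (y, y)) ` (C - {0})) = card C - 1"
    using zero fin by (subst card_image) (auto intro: inj_onI simp: card_Diff_singleton)
  finally have L: "card ?L \<le> card C - 1 + card ?Z" .
  have sw: "card (prod.swap ` ?T) = card ?T" by (rule card_image) (auto simp: inj_on_def)
  have "card ?T + card (prod.swap ` ?T)
     = card (?T \<union> prod.swap ` ?T) + card (?T \<inter> prod.swap ` ?T)"
    by (rule card_Un_Int) (use finT in auto)
  moreover have "card (?T \<union> prod.swap ` ?T) \<le> card ?O"
    by (intro card_mono finite_offdiag fin) auto
  ultimately have T: "2 * card ?T \<le> card ?O + card (?T \<inter> prod.swap ` ?T)"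
    using sw by linarith
  have I: "z - y = \<omega> \<and> \<omega> \<noteq> 0" if "(y, z) \<in> ?T \<inter> prod.swap ` ?T" for y z
  proof -
    have "z - y \<in> C" "- (z - y) \<in> C" "y \<noteq> z" using that by auto
    then show ?thesis using neg[of "z - y"] by auto
  qed
  \<comment> \<open>The summand 2 comes from \<open>?Q = C\<close> having two elements if
    \<open>\<omega> = 0\<close>, and otherwise from the pair \<open>(\<omega>, 0)\<close>, which
    lies in \<open>?T\<close> but not in \<open>?Z\<close>.\<close>
  have TZ: "2 * card ?Z + 2 \<le> card ?O + card ?Q"
  proof (cases "\<omega> = 0")
    case True
    have "?T \<inter> prod.swap ` ?T = {}"
      using I True by fast
    then have "card (?T \<inter> prod.swap ` ?T) = 0" by (metis card.empty)
    moreover have "card ?Q = card C" using True by auto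
    moreover have "card ?Z \<le> card ?T" by (intro card_mono finT) auto
    ultimately show ?thesis using T assms by linarith
  next
    case False
    have "?T \<inter> prod.swap ` ?T \<subseteq> (\<lambda>y. (y, y + \<omega>)) ` ?Q"
    proof clarify
      fix y z y' z' assume a: "y \<in> C" "z \<in> C" "y \<noteq> z" "z - y \<in> C" "(y, z) = prod.swap (y', z')"
         "y' \<in> C" "z' \<in> C" "y' \<noteq> z'" "z' - y' \<in> C"
      then have "(y, z) \<in> ?T \<inter> prod.swap ` ?T" by auto
      from I[OF this] have "z = y + \<omega>" by (auto simp: algebra_simps)
      then show "(y, z) \<in> (\<lambda>y. (y, y + \<omega>)) ` ?Q" using a by auto
    qed
    then have "card (?T \<inter> prod.swap ` ?T) \<le> card ((\<lambda>y. (y, y + \<omega>)) ` ?Q)"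
      by (intro card_mono) (use fin in auto)
    also have "\<dots> \<le> card ?Q" by (rule card_image_le) (use fin in auto)
    finally have 1: "card (?T \<inter> prod.swap ` ?T) \<le> card ?Q" .
    have "- \<omega> = \<omega>" using om(2) by (metis add_eq_0_iff)
    then have "(\<omega>, 0) \<in> ?T" using om zero False by auto
    then have "?Z \<subset> ?T" by auto
    then have "card ?Z < card ?T" by (rule psubset_card_mono[OF finT])
    then show ?thesis using T 1 by linarith
  qed
  have "(\<Sum>c\<in>C - {0}. card (rreps C c)) = card ?L"
    by (rule sum_card_rreps_subset) (use fin in auto)
  then show ?thesis using L TZ card_offdiag[OF fin] assms by linarith
qed

text \<open>Ordered pairs of distinct elements are counted by their sum: about half have it in
  \<open>C\<close>, and each sum in \<open>B\<close> arises at most about \<open>card B\<close>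
  times, so \<open>card B\<close> is at least about \<open>card C / sqrt 2\<close>. The corrections
  due to \<omega> are \<open>?Q\<close> and \<open>?E\<close>; shifting \<open>?E\<close> by
  \<omega> puts it inside \<open>C - ?Q\<close>, so together they cost at most
  \<open>card C\<close>.\<close>

lemma quadratic_bound:
  assumes small: "3 * card B + 5 < 2 * card C"
  shows "card C * card C + 4 \<le> 2 * (card B * card B) + 3 * card B + 4 * card C"
proof -
  let ?Q = "{y \<in> C. y + \<omega> \<in> C}" and ?E = "{c \<in> B. c - \<omega> \<in> C}"
  have C2: "2 \<le> card C" using small by linarith
  have E1: "card ?E \<le> card B" by (intro card_mono finite_B) auto
  have "card ?E = card ((\<lambda>c. c - \<omega>) ` ?E)" by (rule card_image[symmetric]) (auto simp: inj_on_def)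
  also have "\<dots> \<le> card (C - ?Q)" by (intro card_mono) (use fin in auto)
  also have "\<dots> = card C - card ?Q" by (rule card_Diff_subset) (use fin in auto)
  finally have E2: "card ?E + card ?Q \<le> card C"
    using card_mono[of C ?Q] fin by auto
  have "(\<Sum>c\<in>B. card (rreps C c)) \<le> (\<Sum>c\<in>B. card B + 1 + (if c - \<omega> \<in> C then 1 else 0))"
  proof (rule sum_mono)
    fix c assume c: "c \<in> B"
    show "card (rreps C c) \<le> card B + 1 + (if c - \<omega> \<in> C then 1 else 0)"
    proof (cases "\<exists>u\<in>C. \<exists>v\<in>C. c = u - v")
      case True
      then show ?thesis using rreps_le_of_difference[OF c] by blast
    next
      case False
      then have "card (rreps C c) \<le> card B + 1" by (intro rreps_le_of_nondifference c small) blast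
      then show ?thesis by simp
    qed
  qed
  also have "\<dots> = card B * (card B + 1) + card ?E"
    using finite_B by (simp only: sum.distrib sum_constant sum.If_cases)
      (simp add: Int_def conj_commute)
  finally have SB: "(\<Sum>c\<in>B. card (rreps C c)) \<le> card B * (card B + 1) + card ?E" .
  have "(\<Sum>c\<in>rdouble C. card (rreps C c)) = (\<Sum>c\<in>C - {0}. card (rreps C c)) + (\<Sum>c\<in>B. card (rreps C c))"
    by (subst rdouble_split, rule sum.union_disjoint) (use fin finite_B in auto)
  moreover have "(\<Sum>c\<in>rdouble C. card (rreps C c)) = card {(x, y). x \<in> C \<and> y \<in> C \<and> x \<noteq> y}"
    using sum_card_rreps_subset[OF fin finite_rdouble[OF fin]] rdoubleI[of _ C]
    by (simp cong: conj_cong)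
  ultimately have "card C * card C
      = (\<Sum>c\<in>C - {0}. card (rreps C c)) + (\<Sum>c\<in>B. card (rreps C c)) + card C"
    using card_offdiag[OF fin] by linarith
  then show ?thesis using SB sum_rreps_C[OF C2] E1 E2 by (simp add: algebra_simps)
qed

end

subsection \<open>Small doubling forces a stabilizer\<close>

definition double :: "'a::ab_group_add set \<Rightarrow> 'a set" where
  "double C = {x + y | x y. x \<in> C \<and> y \<in> C}"

definition diff_set :: "'a::ab_group_add set \<Rightarrow> 'a set" where
  "diff_set C = {x - y | x y. x \<in> C \<and> y \<in> C}"

lemma doubleI: "x \<in> C \<Longrightarrow> y \<in> C \<Longrightarrow> x + y \<in> double C"
  unfolding double_def by blast

lemma diff_setI: "x \<in> C \<Longrightarrow> y \<in> C \<Longrightarrow> x - y \<in> diff_set C"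
  unfolding diff_set_def by blast

lemma double_eq_image: "double C = (\<lambda>(x, y). x + y) ` (C \<times> C)"
  unfolding double_def by force

lemma diff_set_eq_image: "diff_set C = (\<lambda>(x, y). x - y) ` (C \<times> C)"
  unfolding diff_set_def by force

lemma finite_double: "finite C \<Longrightarrow> finite (double C)"
  unfolding double_eq_image by simp

lemma finite_diff_set: "finite C \<Longrightarrow> finite (diff_set C)"
  unfolding diff_set_eq_image by simp

lemma sum_card_reps:
  fixes C :: "'a::ab_group_add set"
  assumes "finite C"
  shows "(\<Sum>c\<in>double C. card {x \<in> C. c - x \<in> C}) = card C * card C"
proof -
  have "(\<Sum>c\<in>double C. card {x \<in> C. c - x \<in> C}) = card (Sigma (double C) (\<lambda>c. {x \<in> C. c - x \<in> C}))"
    using assms finite_double[OF assms] by simp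
  also have "\<dots> = card (C \<times> C)"
    by (rule bij_betw_same_card[of "\<lambda>(c, x). (x, c - x)"],
        rule bij_betw_byWitness[where f' = "\<lambda>(x, y). (x + y, x)"])
       (auto simp: double_def)
  finally show ?thesis by (simp add: card_cartesian_product)
qed

lemma sum_card_diff_reps:
  fixes C :: "'a::ab_group_add set"
  assumes "finite C"
  shows "(\<Sum>d\<in>diff_set C. card {x \<in> C. x + d \<in> C}) = card C * card C"
proof -
  have "(\<Sum>d\<in>diff_set C. card {x \<in> C. x + d \<in> C}) = card (Sigma (diff_set C) (\<lambda>d. {x \<in> C. x + d \<in> C}))"
    using assms finite_diff_set[OF assms] by simp
  also have "\<dots> = card (C \<times> C)"
    by (rule bij_betw_same_card[of "\<lambda>(d, x). (x, x + d)"],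
        rule bij_betw_byWitness[where f' = "\<lambda>(x, y). (y - x, x)"])
       (auto simp: diff_set_def)
  finally show ?thesis by (simp add: card_cartesian_product)
qed

lemma ex_Int_of_card:
  assumes "finite C" "P \<subseteq> C" "Q \<subseteq> C" "card C < card P + card Q"
  shows "\<exists>x. x \<in> P \<and> x \<in> Q"
proof (rule ccontr)
  assume "\<not> ?thesis"
  then have "card (P \<union> Q) = card P + card Q"
    by (intro card_Un_disjoint) (use assms finite_subset in auto)
  moreover have "card (P \<union> Q) \<le> card C" by (intro card_mono) (use assms in auto)
  ultimately show False using assms(4) by linarith
qed

lemma card_le_card_double:
  assumes "finite C"
  shows "card C \<le> card (double C)"
proof (cases "C = {}")
  case False
  then obtain a where "a \<in> C" by blast
  then have "card ((+) a ` C) \<le> card (double C)"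
    by (intro card_mono finite_double assms) (auto intro: doubleI)
  then show ?thesis by (simp add: card_image)
qed simp

definition stab :: "'a::ab_group_add set \<Rightarrow> 'a set" where
  "stab S = {h. (+) h ` S = S}"

text \<open>Averaging yields a sum \<open>c\<close> with more than \<open>T - m\<close> representations, which forces
  \<open>c + (C - C) \<subseteq> C + C\<close> and hence \<open>|C - C| \<le> T\<close>. Then every sum has at least \<open>2 m - T\<close> representations,
  so a difference with more than \<open>T - m\<close> representations stabilizes \<open>C + C\<close>.\<close>

lemma small_doubling_stabilizer:
  fixes C :: "'a::ab_group_add set"
  assumes fin: "finite C" and ne: "C \<noteq> {}"
    and m: "m = int (card C)" and T: "T = int (card (double C))"
    and small: "T * (T - m) < m * m"
  shows "m * m \<le> int (card (stab (double C))) * (2 * m - T) + T * (T - m)"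
proof -
  let ?S = "double C" and ?D = "diff_set C" and ?K = "stab (double C)"
  note finS = finite_double[OF fin] and finD = finite_diff_set[OF fin]
  have mpos: "m > 0" using m fin ne by (simp add: card_gt_0_iff)
  have Tm: "m \<le> T" using card_le_card_double[OF fin] m T by simp
  have T2: "T < 2 * m"
  proof (rule ccontr)
    assume "\<not> ?thesis"
    then have "m * m \<le> T * (T - m)" using mpos by (intro mult_mono) auto
    then show False using small by simp
  qed
  have diff_reps: "2 * m - T \<le> int (card {x \<in> C. x + d \<in> C})" if "d \<in> ?D" for d
  proof -
    obtain u v where uv: "u \<in> C" "v \<in> C" "d = v - u" using \<open>d \<in> ?D\<close> by (auto simp: diff_set_def)
    let ?U = "(\<lambda>x. x + u) ` C" and ?W = "(\<lambda>x. x + v) ` C"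
    have "card (?U \<union> ?W) \<le> card ?S"
      by (intro card_mono finS) (use uv in \<open>auto intro: doubleI\<close>)
    moreover have "card ?U + card ?W = card (?U \<union> ?W) + card (?U \<inter> ?W)"
      by (rule card_Un_Int) (use fin in auto)
    moreover have "card ?U = card C" "card ?W = card C" by (simp_all add: card_image)
    moreover have "card (?U \<inter> ?W) = card {x \<in> C. x + d \<in> C}"
      using card_Int_translates[OF fin, of u v] unfolding uv(3) by (simp add: add_diff_eq)
    ultimately show ?thesis using m T by linarith
  qed
  have "\<exists>c\<in>?S. T - m < int (card {x \<in> C. c - x \<in> C})"
  proof (rule ccontr)
    assume "\<not> ?thesis"
    then have "(\<Sum>c\<in>?S. int (card {x \<in> C. c - x \<in> C})) \<le> (\<Sum>c\<in>?S. T - m)"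
      by (intro sum_mono) auto
    moreover have "(\<Sum>c\<in>?S. int (card {x \<in> C. c - x \<in> C})) = m * m"
      using arg_cong[OF sum_card_reps[OF fin], of int] m by simp
    ultimately show False using small T by simp
  qed
  then obtain c where c: "c \<in> ?S" "T - m < int (card {x \<in> C. c - x \<in> C})" by blast
  \<comment> \<open>More than \<open>T - m\<close> representations of \<open>c\<close> and at least
    \<open>2 * m - T\<close> of \<open>d\<close> must share an \<open>x\<close> in \<open>C\<close>,
    and \<open>c + d = (c - x) + (x + d)\<close>.\<close>
  have "c + d \<in> ?S" if "d \<in> ?D" for d
  proof -
    have "\<exists>x. x \<in> {x \<in> C. c - x \<in> C} \<and> x \<in> {x \<in> C. x + d \<in> C}"
      by (rule ex_Int_of_card[OF fin]) (use c(2) diff_reps[OF that] m in auto)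
    then obtain x where "c - x \<in> C" "x + d \<in> C" by auto
    from doubleI[OF this] show ?thesis by simp
  qed
  then have "card ((+) c ` ?D) \<le> card ?S" by (intro card_mono finS) auto
  then have D: "int (card ?D) \<le> T" using T by (simp add: card_image)
  \<comment> \<open>For \<open>s = a + b\<close>, both \<open>C - a\<close> and \<open>b - C\<close>
    lie in the difference set, which by \<open>D\<close> has at most \<open>T\<close> elements;
    their common elements correspond to representations of \<open>s\<close>.\<close>
  have reps: "2 * m - T \<le> int (card {x \<in> C. s - x \<in> C})" if "s \<in> ?S" for s
  proof -
    obtain a b where ab: "a \<in> C" "b \<in> C" "s = a + b" using \<open>s \<in> ?S\<close> by (auto simp: double_def)
    let ?U = "(\<lambda>x. x - a) ` C" and ?W = "(\<lambda>x. b - x) ` C"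
    have "card (?U \<union> ?W) \<le> card ?D"
      by (intro card_mono finD) (use ab in \<open>auto intro: diff_setI\<close>)
    moreover have "card ?U + card ?W = card (?U \<union> ?W) + card (?U \<inter> ?W)"
      by (rule card_Un_Int) (use fin in auto)
    moreover have "card ?U = card C" by (rule card_image) (auto simp: inj_on_def)
    moreover have "card ?W = card C" by (rule card_image) (auto simp: inj_on_def)
    moreover have "card (?U \<inter> ?W) \<le> card ((\<lambda>x. x - a) ` {x \<in> C. s - x \<in> C})"
    proof (intro card_mono)
      show "?U \<inter> ?W \<subseteq> (\<lambda>x. x - a) ` {x \<in> C. s - x \<in> C}"
      proof
        fix z assume "z \<in> ?U \<inter> ?W"
        then obtain x y where xy: "x \<in> C" "y \<in> C" "z = x - a" "z = b - y" by auto
        have "y = s - x" using xy(3,4) ab(3) by (simp add: algebra_simps)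
        then show "z \<in> (\<lambda>x. x - a) ` {x \<in> C. s - x \<in> C}" using xy by blast
      qed
    qed (use fin in auto)
    moreover have "card ((\<lambda>x. x - a) ` {x \<in> C. s - x \<in> C}) \<le> card {x \<in> C. s - x \<in> C}"
      by (rule card_image_le) (use fin in auto)
    ultimately show ?thesis using m T D by linarith
  qed
  have outside: "int (card {x \<in> C. x + d \<in> C}) \<le> T - m" if "d \<notin> ?K" for d
  proof (rule ccontr)
    assume a: "\<not> ?thesis"
    have "d + s \<in> ?S" if "s \<in> ?S" for s
    proof -
      have "\<exists>x. x \<in> {x \<in> C. s - x \<in> C} \<and> x \<in> {x \<in> C. x + d \<in> C}"
        by (rule ex_Int_of_card[OF fin]) (use a reps[OF that] m in auto)
      then obtain x where "s - x \<in> C" "x + d \<in> C" by auto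
      from doubleI[OF this] show ?thesis by (simp add: add.commute)
    qed
    then have "(+) d ` ?S \<subseteq> ?S" by blast
    then have "(+) d ` ?S = ?S" by (intro card_subset_eq finS) (auto simp: card_image)
    then show False using that by (simp add: stab_def)
  qed
  have finK: "finite ?K"
  proof (rule finite_subset)
    show "?K \<subseteq> (\<lambda>s. s - c) ` ?S"
    proof
      fix h assume "h \<in> ?K"
      then have "h + c \<in> ?S" using c(1) by (auto simp: stab_def)
      then have "h + c - c \<in> (\<lambda>s. s - c) ` ?S" by blast
      then show "h \<in> (\<lambda>s. s - c) ` ?S" by simp
    qed
  qed (use finS in auto)
  \<comment> \<open>All pairs are counted by their difference: one outside the stabilizer occurs at
    most \<open>T - m\<close> times, one inside at most \<open>m = (T - m) + (2 * m - T)\<close>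
    times.\<close>
  have "m * m = (\<Sum>d\<in>?D. int (card {x \<in> C. x + d \<in> C}))"
    using arg_cong[OF sum_card_diff_reps[OF fin], of int] m by simp
  also have "\<dots> \<le> (\<Sum>d\<in>?D. (T - m) + (if d \<in> ?K then 2 * m - T else 0))"
  proof (rule sum_mono)
    fix d
    have "card {x \<in> C. x + d \<in> C} \<le> card C" by (intro card_mono fin) auto
    then show "int (card {x \<in> C. x + d \<in> C}) \<le> (T - m) + (if d \<in> ?K then 2 * m - T else 0)"
      using outside[of d] m by auto
  qed
  also have "\<dots> = int (card ?D) * (T - m) + int (card (?D \<inter> ?K)) * (2 * m - T)"
    using finD by (simp add: sum.distrib sum.If_cases)
  also have "\<dots> \<le> T * (T - m) + int (card ?K) * (2 * m - T)"
  proof (intro add_mono mult_right_mono)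
    have "card (?D \<inter> ?K) \<le> card ?K" by (intro card_mono finK) auto
    then show "int (card (?D \<inter> ?K)) \<le> int (card ?K)" by simp
  qed (use D Tm T2 in auto)
  finally show ?thesis by simp
qed

subsection \<open>Residues in the circle group\<close>

text \<open>The group \<open>\<real> / \<int>\<close> contains a copy of \<open>\<int> / l\<close> for every \<open>l\<close>, so residues modulo different
  numbers live in one type.\<close>

quotient_type circle = real / "\<lambda>x y. x - y \<in> \<int>"
proof (rule equivpI)
  show "reflp (\<lambda>x y::real. x - y \<in> \<int>)" by (simp add: reflp_def)
  show "symp (\<lambda>x y::real. x - y \<in> \<int>)"
    by (auto simp: symp_def) (metis Ints_minus minus_diff_eq)
  show "transp (\<lambda>x y::real. x - y \<in> \<int>)"
    by (auto simp: transp_def) (metis Ints_add diff_add_cancel add_diff_eq)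
qed

instantiation circle :: ab_group_add
begin

lift_definition zero_circle :: circle is 0 .
lift_definition plus_circle :: "circle \<Rightarrow> circle \<Rightarrow> circle" is "(+)"
  by (metis Ints_add add_diff_add)
lift_definition uminus_circle :: "circle \<Rightarrow> circle" is uminus
  by (metis Ints_minus minus_diff_minus)
lift_definition minus_circle :: "circle \<Rightarrow> circle \<Rightarrow> circle" is "(-)"
  by (metis Ints_diff diff_diff_eq diff_diff_eq2 add.commute diff_add_eq)

instance
  by standard (transfer, simp add: algebra_simps)+

end

lift_definition half_turn :: circle is "1 / 2" .

lemma half_turn_double: "half_turn + half_turn = 0"
  by transfer simp

lemma circle_double_eq_0: "x + x = 0 \<Longrightarrow> x = 0 \<or> x = half_turn" for x :: circle
proof (transfer)
  fix x :: real assume "x + x - 0 \<in> \<int>"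
  then obtain k where k: "x + x = of_int k" by (auto elim: Ints_cases)
  show "x - 0 \<in> \<int> \<or> x - 1 / 2 \<in> \<int>"
  proof (cases "even k")
    case True
    then obtain j where "k = 2 * j" by blast
    then have "x = of_int j" using k by simp
    then show ?thesis by simp
  next
    case False
    then obtain j where "k = 2 * j + 1" by (blast elim: oddE)
    then have "x - 1 / 2 = of_int j" using k by simp
    then show ?thesis by (metis Ints_of_int)
  qed
qed

text \<open>Two halves of the same element differ by 0 or by \<open>half_turn\<close>.\<close>

lemma card_circle_halves:
  fixes z :: circle
  shows "card {x \<in> C. x + x = z} \<le> 2"
proof (cases "\<exists>a. a + a = z")
  case True
  then obtain a where a: "a + a = z" by blast
  have "{x \<in> C. x + x = z} \<subseteq> {a, a + half_turn}"
  proof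
    fix x assume "x \<in> {x \<in> C. x + x = z}"
    then have "(x - a) + (x - a) = 0" using a by (simp add: algebra_simps)
    then have "x - a = 0 \<or> x - a = half_turn" by (rule circle_double_eq_0)
    then show "x \<in> {a, a + half_turn}" by (auto simp: algebra_simps)
  qed
  then have "card {x \<in> C. x + x = z} \<le> card {a, a + half_turn}" by (intro card_mono) auto
  also have "\<dots> \<le> 2" by (simp add: card_insert_if)
  finally show ?thesis .
qed auto

text \<open>The integers modulo \<open>l\<close> appear as the points \<open>z / l\<close>; for
  \<open>l > 0\<close> the kernel consists of the multiples of \<open>l\<close>.\<close>

lift_definition residue :: "int \<Rightarrow> int \<Rightarrow> circle" is "\<lambda>l z. of_int z / of_int l" .

lemma residue_0 [simp]: "residue l 0 = 0"
  by transfer simp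

lemma residue_add: "residue l (x + y) = residue l x + residue l y"
  by transfer (simp add: add_divide_distrib)

lemma residue_diff: "residue l (x - y) = residue l x - residue l y"
  by transfer (simp add: diff_divide_distrib)

lemma residue_eq_0_iff: "l > 0 \<Longrightarrow> residue l x = 0 \<longleftrightarrow> l dvd x"
proof (transfer)
  fix l x :: int assume l: "l > 0"
  show "real_of_int x / real_of_int l - 0 \<in> \<int> \<longleftrightarrow> l dvd x"
  proof
    assume "real_of_int x / real_of_int l - 0 \<in> \<int>"
    then obtain k where "real_of_int x / real_of_int l = of_int k" by (auto elim: Ints_cases)
    then have "real_of_int x = of_int (l * k)" using l by (simp add: field_simps)
    then have "x = l * k" by (simp only: of_int_eq_iff)
    then show "l dvd x" by simp
  next
    assume "l dvd x"
    then obtain k where "x = l * k" by blast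
    then show "real_of_int x / real_of_int l - 0 \<in> \<int>" using l by simp
  qed
qed

lemma residue_eq_iff: "l > 0 \<Longrightarrow> residue l x = residue l y \<longleftrightarrow> l dvd x - y"
  using residue_eq_0_iff[of l "x - y"] by (simp add: residue_diff)

lemma inj_on_residue: "l > 0 \<Longrightarrow> inj_on (residue l) {0..<l}"
proof (rule inj_onI)
  fix x y assume a: "l > 0" "x \<in> {0..<l}" "y \<in> {0..<l}" "residue l x = residue l y"
  then have "x mod l = y mod l" by (metis residue_eq_iff mod_eq_dvd_iff)
  then show "x = y" using a by simp
qed

lemma residue_mod: "l > 0 \<Longrightarrow> residue l (x mod l) = residue l x"
  by (simp add: residue_eq_iff mod_eq_dvd_iff[symmetric])

lemma range_residue: "l > 0 \<Longrightarrow> range (residue l) = residue l ` {0..<l}"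
  by (auto intro!: image_eqI[of _ _ "_ mod l"] simp: residue_mod)

subsection \<open>Sets of integers and their residues\<close>

text \<open>Translating by \<open>d\<close> moves the isolated double to 0 and gives an instance of
  \<open>isolated_double\<close>; \<open>b\<close> is the size of \<open>B\<close> there.\<close>

lemma isolated_double_circle:
  fixes P :: "circle set"
  assumes fin: "finite P" and d: "d \<in> P" "d + d \<notin> rdouble P"
  obtains b where "card (rdouble P) + 1 = card P + b"
    and "3 * b + 5 < 2 * card P \<Longrightarrow> card P * card P + 4 \<le> 2 * (b * b) + 3 * b + 4 * card P"
proof -
  define C where "C = (\<lambda>x. x - d) ` P"
  define \<omega> where "\<omega> = (if half_turn \<in> C then half_turn else 0)"
  have rd: "rdouble C = (\<lambda>x. x - (d + d)) ` rdouble P"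
  proof (intro set_eqI iffI)
    fix z assume "z \<in> rdouble C"
    then obtain x y where "x \<in> P" "y \<in> P" "x \<noteq> y" "z = (x - d) + (y - d)"
      by (auto simp: rdouble_def C_def)
    then have "x + y \<in> rdouble P" "z = (x + y) - (d + d)" by (auto intro: rdoubleI simp: algebra_simps)
    then show "z \<in> (\<lambda>x. x - (d + d)) ` rdouble P" by blast
  next
    fix z assume "z \<in> (\<lambda>x. x - (d + d)) ` rdouble P"
    then obtain x y where xy: "x \<in> P" "y \<in> P" "x \<noteq> y" "z = (x - d) + (y - d)"
      by (auto simp: rdouble_def algebra_simps)
    then show "z \<in> rdouble C" unfolding xy(4) by (intro rdoubleI) (auto simp: C_def)
  qed
  have zero: "0 \<in> C" using d(1) unfolding C_def by (intro image_eqI[of _ _ d]) auto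
  interpret isolated_double C \<omega>
  proof
    show "finite C" using fin by (simp add: C_def)
    show "0 \<in> C" by fact
    show "\<omega> \<in> C" using zero by (simp add: \<omega>_def)
    show "\<omega> + \<omega> = 0" by (simp add: \<omega>_def half_turn_double)
    show "0 \<notin> rdouble C" unfolding rd using d(2) by auto
    show "x = 0 \<or> x = \<omega>" if "x \<in> C" "x + x = 0" for x
      using circle_double_eq_0[OF that(2)] that(1) by (auto simp: \<omega>_def)
    show "card {x \<in> C. x + x = z} \<le> 2" for z by (rule card_circle_halves)
  qed
  have cC: "card C = card P" unfolding C_def by (rule card_image) (auto simp: inj_on_def)
  have cR: "card (rdouble C) = card (rdouble P)"
    unfolding rd by (rule card_image) (auto simp: inj_on_def)
  show thesis using that[of "card B"] card_rdouble quadratic_bound cC cR by simp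
qed

text \<open>\<open>P + Min Q\<close> and \<open>Max P + Q\<close> share at most the sum
  \<open>Max P + Min Q\<close>. The loss of 3 consists of this sum and of at most one pair of equal
  summands in each translate.\<close>

lemma card_distinct_sums:
  fixes P Q :: "int set"
  assumes "finite P" "finite Q" "P \<noteq> {}" "Q \<noteq> {}"
  shows "card P + card Q \<le> card {p + q | p q. p \<in> P \<and> q \<in> Q \<and> p \<noteq> q} + 3"
proof -
  let ?S = "{p + q | p q. p \<in> P \<and> q \<in> Q \<and> p \<noteq> q}"
  define a where "a = Min Q"
  define z where "z = Max P"
  have az: "a \<in> Q" "z \<in> P" using assms by (auto simp: a_def z_def)
  let ?U = "(\<lambda>p. p + a) ` (P - {a})" and ?V = "(\<lambda>q. z + q) ` (Q - {z})"
  have finS: "finite ?S"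
    by (rule finite_subset[of _ "(\<lambda>(p, q). p + q) ` (P \<times> Q)"]) (use assms in auto)
  have "card ?U = card (P - {a})" by (rule card_image) (auto simp: inj_on_def)
  moreover have "card ?V = card (Q - {z})" by (rule card_image) (auto simp: inj_on_def)
  moreover have "card P \<le> card (P - {a}) + 1" "card Q \<le> card (Q - {z}) + 1"
    by (simp_all only: card_Diff_singleton_if split: if_split) arith+
  moreover have "card ?U + card ?V = card (?U \<union> ?V) + card (?U \<inter> ?V)"
    by (rule card_Un_Int) (use assms in auto)
  moreover have "card (?U \<inter> ?V) \<le> card {z + a}"
  proof (intro card_mono)
    show "?U \<inter> ?V \<subseteq> {z + a}"
    proof
      fix y assume "y \<in> ?U \<inter> ?V"
      then obtain p where p: "p \<in> P" "y = p + a" by blast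
      from \<open>y \<in> ?U \<inter> ?V\<close> obtain q where q: "q \<in> Q" "y = z + q" by blast
      have "p \<le> z" "a \<le> q" using p q assms by (auto simp: a_def z_def)
      then show "y \<in> {z + a}" using p q by simp
    qed
  qed simp
  moreover have "card (?U \<union> ?V) \<le> card ?S"
    by (intro card_mono finS) (use az in auto)
  ultimately show ?thesis by simp
qed

lemma int_subgroup_generator:
  fixes \<Pi> :: "int set"
  assumes diff: "\<And>p q. p \<in> \<Pi> \<Longrightarrow> q \<in> \<Pi> \<Longrightarrow> p - q \<in> \<Pi>" and l: "l \<in> \<Pi>" "l > 0"
  shows "\<exists>g>0. \<forall>p. p \<in> \<Pi> \<longleftrightarrow> g dvd p"
proof -
  define n where "n = (LEAST n. n > 0 \<and> int n \<in> \<Pi>)"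
  have "\<exists>n. n > 0 \<and> int n \<in> \<Pi>" using l by (intro exI[of _ "nat l"]) auto
  then have n: "n > 0" "int n \<in> \<Pi>" unfolding n_def by (metis (mono_tags, lifting) LeastI)+
  have least: "n \<le> k" if "k > 0" "int k \<in> \<Pi>" for k
    unfolding n_def using that by (intro Least_le) auto
  have zero: "0 \<in> \<Pi>" using diff[OF l(1) l(1)] by simp
  have neg: "- p \<in> \<Pi>" if "p \<in> \<Pi>" for p using diff[OF zero that] by simp
  have add: "p + q \<in> \<Pi>" if "p \<in> \<Pi>" "q \<in> \<Pi>" for p q using diff[OF that(1) neg[OF that(2)]] by simp
  have mult: "int n * int k \<in> \<Pi>" for k
    by (induction k) (use zero n add in \<open>auto simp: algebra_simps\<close>)
  have mult': "int n * j \<in> \<Pi>" for j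
    using mult[of "nat j"] neg[OF mult[of "nat (- j)"]] by (cases "j \<ge> 0") simp_all
  have "int n dvd p" if "p \<in> \<Pi>" for p
  proof (rule ccontr)
    assume a: "\<not> int n dvd p"
    have "p mod int n = p - int n * (p div int n)" by (simp add: minus_mult_div_eq_mod)
    then have "p mod int n \<in> \<Pi>" using diff[OF that mult'] by simp
    moreover have "p mod int n > 0" using a n
      by (metis dvd_eq_mod_eq_0 of_nat_0_less_iff order_le_less pos_mod_sign)
    ultimately have "n \<le> nat (p mod int n)" by (intro least) auto
    moreover have "p mod int n < int n" using n by simp
    ultimately show False using \<open>p mod int n > 0\<close> by linarith
  qed
  then have "p \<in> \<Pi> \<longleftrightarrow> int n dvd p" for p using mult' by (auto elim!: dvdE)
  then show ?thesis using n by (intro exI[of _ "int n"]) simp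
qed

lemma card_residue_fiber:
  assumes "g > 0" "h \<ge> 0" "c \<in> range (residue g)"
  shows "card {z \<in> {0..<g * h}. residue g z = c} = nat h"
proof -
  obtain z0 where z0: "c = residue g z0" using assms by auto
  let ?r = "z0 mod g"
  have r: "0 \<le> ?r" "?r < g" using assms by auto
  have "{z \<in> {0..<g * h}. residue g z = c} = (\<lambda>q. ?r + g * q) ` {0..<h}"
  proof (intro set_eqI iffI)
    fix z assume "z \<in> {z \<in> {0..<g * h}. residue g z = c}"
    then have z: "0 \<le> z" "z < g * h" "residue g z = residue g z0" using z0 by auto
    then have "z mod g = ?r" using assms(1) by (metis residue_eq_iff mod_eq_dvd_iff)
    then have "z = ?r + g * (z div g)" by (metis add.commute mult_div_mod_eq)
    moreover have "0 \<le> z div g" using z assms(1) by (simp add: pos_imp_zdiv_nonneg_iff)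
    moreover have "z div g < h"
    proof -
      have "g * (z div g) < g * h" using calculation z r by linarith
      then show ?thesis using assms(1) by simp
    qed
    ultimately show "z \<in> (\<lambda>q. ?r + g * q) ` {0..<h}" by (intro image_eqI[of _ _ "z div g"]) auto
  next
    fix z assume "z \<in> (\<lambda>q. ?r + g * q) ` {0..<h}"
    then obtain q where q: "0 \<le> q" "q < h" "z = ?r + g * q" by auto
    have "g * q + g \<le> g * h" using q assms(1) mult_left_mono[of "q + 1" h g] by (simp add: algebra_simps)
    moreover have "0 \<le> g * q" using q assms(1) by simp
    moreover have "residue g z = c" unfolding z0 q(3) residue_add
      using assms(1) by (simp add: residue_mod residue_eq_0_iff)
    ultimately show "z \<in> {z \<in> {0..<g * h}. residue g z = c}" using q r by auto
  qed
  moreover have "inj_on (\<lambda>q. ?r + g * q) {0..<h}" using assms(1) by (auto simp: inj_on_def)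
  ultimately show ?thesis by (simp add: card_image)
qed

lemma card_residue_preimage:
  assumes "g > 0" "h \<ge> 0" "finite U" "U \<subseteq> range (residue g)"
  shows "card {z \<in> {0..<g * h}. residue g z \<in> U} = card U * nat h"
proof -
  have "{z \<in> {0..<g * h}. residue g z \<in> U} = (\<Union>c\<in>U. {z \<in> {0..<g * h}. residue g z = c})" by auto
  also have "card \<dots> = (\<Sum>c\<in>U. card {z \<in> {0..<g * h}. residue g z = c})"
    by (rule card_UN_disjoint) (use assms in \<open>auto intro: finite_subset[of _ "{0..<g * h}"]\<close>)
  also have "\<dots> = (\<Sum>c\<in>U. nat h)"
    by (rule sum.cong) (use assms card_residue_fiber in auto)
  finally show ?thesis by simp
qed

section \<open>Reduction modulo the largest element\<close>

locale normal_set =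
  fixes X :: "int set" and l :: int
  assumes fin: "finite X" and sub: "X \<subseteq> {0..l}" and zero: "0 \<in> X" and top: "l \<in> X"
    and l: "l > 0"
begin

abbreviation "P \<equiv> residue l ` X"

lemma residue_top: "residue l l = 0" using l by (simp add: residue_eq_0_iff)

lemma card_P: "card P + 1 = card X"
proof -
  have "P = residue l ` (X - {l})"
  proof
    show "P \<subseteq> residue l ` (X - {l})"
    proof (intro image_subsetI)
      fix x assume "x \<in> X"
      show "residue l x \<in> residue l ` (X - {l})"
      proof (cases "x = l")
        case True
        then show ?thesis using zero l by (intro image_eqI[of _ _ 0]) (auto simp: residue_top)
      qed (use \<open>x \<in> X\<close> in auto)
    qed
  qed auto
  moreover have "inj_on (residue l) (X - {l})"
    by (rule inj_on_subset[OF inj_on_residue[OF l]]) (use sub in force)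
  ultimately have "card P = card (X - {l})" by (simp add: card_image)
  then show ?thesis using card_Suc_Diff1[OF fin top] by simp
qed

lemma rdouble_members:
  assumes "x \<in> X - {0, l}"
  shows "x \<in> rdouble X" "x + l \<in> rdouble X"
  using assms rdoubleI[OF zero, of x] rdoubleI[OF _ top, of x] by auto

text \<open>The elements \<open>x + l\<close> with \<open>x \<in> X - {0, l}\<close> can be deleted
  from \<open>Q\<close> without losing a residue, since \<open>x\<close> remains. The set
  \<open>Q\<close> is arbitrary so that the count also applies to the part of
  \<open>rdouble X\<close> in selected cosets.\<close>

lemma card_ge_residues:
  assumes "finite Q" and mem: "\<And>x. x \<in> X - {0, l} \<Longrightarrow> x \<in> Q \<and> x + l \<in> Q"
  shows "card (residue l ` Q) + card X \<le> card Q + 2"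
proof -
  let ?E = "(\<lambda>x. x + l) ` (X - {0, l})"
  have "residue l ` Q \<subseteq> residue l ` (Q - ?E)"
  proof (intro image_subsetI)
    fix q assume q: "q \<in> Q"
    show "residue l q \<in> residue l ` (Q - ?E)"
    proof (cases "q \<in> ?E")
      case True
      then obtain x where x: "x \<in> X - {0, l}" "q = x + l" by blast
      have "x \<notin> ?E"
      proof
        assume "x \<in> ?E"
        then obtain y where "y \<in> X" "y \<noteq> 0" "x = y + l" by auto
        moreover have "y \<ge> 0" "x \<le> l" using sub \<open>y \<in> X\<close> x(1) by auto
        ultimately show False by simp
      qed
      moreover have "residue l q = residue l x" using x by (simp add: residue_add residue_top)
      ultimately show ?thesis using mem[OF x(1)] by blast
    qed (use q in auto)
  qed
  then have "card (residue l ` Q) \<le> card (residue l ` (Q - ?E))"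
    by (intro card_mono) (use assms in auto)
  also have "\<dots> \<le> card (Q - ?E)" by (rule card_image_le) (use assms in auto)
  also have "\<dots> = card Q - card ?E" by (rule card_Diff_subset) (use fin mem in auto)
  finally have "card (residue l ` Q) \<le> card Q - card ?E" .
  moreover have "card ?E \<le> card Q" by (intro card_mono) (use assms in auto)
  moreover have "card ?E = card (X - {0, l})" by (rule card_image) (auto simp: inj_on_def)
  moreover have "card (X - {0, l}) = card X - 2"
    using zero top l fin by (subst card_Diff_subset) auto
  moreover have "card X \<ge> 2"
    using card_mono[OF fin, of "{0, l}"] zero top l by auto
  ultimately show ?thesis by linarith
qed

lemma rdouble_residues: "rdouble P \<subseteq> residue l ` rdouble X"
proof
  fix z assume "z \<in> rdouble P"
  then obtain x y where "x \<in> X" "y \<in> X" "residue l x \<noteq> residue l y" "z = residue l (x + y)"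
    by (auto simp: rdouble_def residue_add)
  then show "z \<in> residue l ` rdouble X" using rdoubleI[of x X y] by blast
qed

lemma card_rdouble_ge: "card (rdouble P) + card X \<le> card (rdouble X) + 2"
proof -
  have "card (rdouble P) \<le> card (residue l ` rdouble X)"
    by (intro card_mono rdouble_residues) (use fin finite_rdouble in auto)
  then show ?thesis
    using card_ge_residues[OF finite_rdouble[OF fin]] rdouble_members by force
qed

text \<open>Since \<open>2 * card P \<ge> l + 3\<close>, the sets \<open>P\<close> and
  \<open>c - P\<close> share at least three residues for every class \<open>c\<close> modulo
  \<open>l\<close>. At most two of them are halves of \<open>c\<close>, so another one gives
  distinct summands.\<close>

lemma dense_bound:
  assumes "l + 5 \<le> 2 * int (card X)"
  shows "l + int (card X) \<le> int (card (rdouble X)) + 2"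
proof -
  let ?G = "residue l ` {0..<l}"
  have cG: "card ?G = nat l" using inj_on_residue[OF l] by (simp add: card_image)
  have "?G \<subseteq> rdouble P"
  proof
    fix c assume "c \<in> ?G"
    then obtain z where z: "c = residue l z" by blast
    let ?Q = "(\<lambda>x. c - x) ` P"
    have "P \<union> ?Q \<subseteq> range (residue l)" unfolding z by (auto simp: residue_diff[symmetric])
    then have "card (P \<union> ?Q) \<le> nat l"
      unfolding cG[symmetric] range_residue[OF l] by (intro card_mono) auto
    moreover have "card P + card ?Q = card (P \<union> ?Q) + card (P \<inter> ?Q)"
      by (rule card_Un_Int) (use fin in auto)
    moreover have "card ?Q = card P" by (rule card_image) (auto simp: inj_on_def)
    ultimately have "card (P \<inter> ?Q) > 2" using assms card_P l by linarith
    moreover have "card {x \<in> P. x + x = c} \<le> 2" by (rule card_circle_halves)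
    ultimately have "\<not> P \<inter> ?Q \<subseteq> {x \<in> P. x + x = c}"
      using card_mono[of "{x \<in> P. x + x = c}" "P \<inter> ?Q"] fin by fastforce
    then obtain x y where x: "x \<in> P" "x + x \<noteq> c" "y \<in> P" "x = c - y" by blast
    then have "c = x + y" "x \<noteq> y" by (auto simp: algebra_simps)
    then show "c \<in> rdouble P" using rdoubleI[of x P y] x by simp
  qed
  then have "card ?G \<le> card (rdouble P)" by (intro card_mono finite_rdouble) (use fin in auto)
  then show ?thesis using cG card_rdouble_ge l by linarith
qed

end

context normal_set
begin

text \<open>Here \<open>h\<close> is the order of the stabilizer of the sumset modulo \<open>l\<close>, while \<open>t\<close> and \<open>s\<close> count the cosets
  that meet \<open>X\<close> and \<open>X + X\<close>. The last bound gains from a coset \<open>w\<close> of the sumset that misses \<open>X\<close>,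
  on which the integer sums outnumber their residues.\<close>

lemma periodic_bound:
  assumes all: "\<forall>d\<in>P. d + d \<in> rdouble P" and gcd1: "Gcd X = 1"
    and N: "N = int (card (rdouble X))" and m: "m = int (card X) - 1"
  shows "\<exists>t s h. 1 \<le> h \<and> 1 \<le> t \<and> t \<le> s \<and> m \<le> t * h \<and> (t = 1 \<longrightarrow> h = l) \<and> s * h + m - 1 \<le> N
    \<and> (s * (s - t) < t * t \<longrightarrow> t * t \<le> 2 * t - s + s * (s - t))
    \<and> (s * (s - t) < t * t \<and> 2 \<le> t \<longrightarrow> (s - 1) * h + m - 1 + 2 * (m - (t - 1) * h) - 3 \<le> N)"
proof -
  \<comment> \<open>The periods of the integer preimage \<open>W\<close> of the sumset form a
    subgroup containing \<open>l\<close>. Its generator \<open>g\<close> describes the stabilizer as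
    the multiples of \<open>g\<close> modulo \<open>l\<close>, a group of order
    \<open>h = l / g\<close> whose cosets are the classes modulo \<open>g\<close>.\<close>
  define W where "W = {z. residue l z \<in> double P}"
  define \<Pi> where "\<Pi> = {p. \<forall>z. z + p \<in> W \<longleftrightarrow> z \<in> W}"
  have dP: "double P \<subseteq> rdouble P"
  proof
    fix z assume "z \<in> double P"
    then obtain x y where xy: "x \<in> P" "y \<in> P" "z = x + y" by (auto simp: double_def)
    then show "z \<in> rdouble P" using bspec[OF all, of x] rdoubleI[of x P y] by (cases "x = y") auto
  qed
  have sums_W: "x + y \<in> W" if "x \<in> X" "y \<in> X" for x y
    using that by (auto simp: W_def residue_add intro: doubleI)
  have diff: "p - q \<in> \<Pi>" if "p \<in> \<Pi>" "q \<in> \<Pi>" for p q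
  proof -
    have "z + (p - q) \<in> W \<longleftrightarrow> z \<in> W" for z
    proof -
      have "z + (p - q) \<in> W \<longleftrightarrow> (z + (p - q)) + q \<in> W" using that(2) unfolding \<Pi>_def by blast
      also have "(z + (p - q)) + q = z + p" by simp
      also have "z + p \<in> W \<longleftrightarrow> z \<in> W" using that(1) unfolding \<Pi>_def by blast
      finally show ?thesis .
    qed
    then show ?thesis by (simp add: \<Pi>_def)
  qed
  have "l \<in> \<Pi>" by (simp add: \<Pi>_def W_def residue_add residue_top)
  from int_subgroup_generator[OF diff this l]
  obtain g where g: "g > 0" "\<forall>p. p \<in> \<Pi> \<longleftrightarrow> g dvd p" by blast
  then have "g dvd l" using \<open>l \<in> \<Pi>\<close> by blast
  then obtain h where h: "l = g * h" by blast
  then have h0: "h > 0" using l g(1) by (simp add: zero_less_mult_iff)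
  have res_mono: "residue g x = residue g y" if "residue l x = residue l y" for x y
    using that g(1) l \<open>g dvd l\<close> by (auto simp: residue_eq_iff intro: dvd_trans)
  define A where "A = residue g ` X"
  define S where "S = double A"
  have finA: "finite A" and finS: "finite S" using fin by (auto simp: A_def S_def intro: finite_double)
  have zA: "0 \<in> A" using zero by (force simp: A_def intro: image_eqI[of _ _ 0])
  have zS: "0 \<in> S" using doubleI[OF zA zA] by (simp add: S_def)
  have AS: "A \<subseteq> S" using doubleI[OF zA] by (auto simp: S_def)
  have Sform: "\<exists>x\<in>X. \<exists>y\<in>X. c = residue g (x + y)" if "c \<in> S" for c
    using that by (auto simp: S_def double_def A_def residue_add)
  have W_iff: "z \<in> W \<longleftrightarrow> residue g z \<in> S" for z
  proof
    assume "z \<in> W"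
    then obtain x y where xy: "x \<in> X" "y \<in> X" "residue l z = residue l (x + y)"
      by (auto simp: W_def double_def residue_add)
    then show "residue g z \<in> S" using res_mono[OF xy(3)]
      by (auto simp: S_def A_def residue_add intro: doubleI)
  next
    assume "residue g z \<in> S"
    then obtain x y where xy: "x \<in> X" "y \<in> X" "residue g z = residue g (x + y)" using Sform by blast
    then have "z - (x + y) \<in> \<Pi>" using g by (simp add: residue_eq_iff)
    then have "(x + y) + (z - (x + y)) \<in> W \<longleftrightarrow> x + y \<in> W" unfolding \<Pi>_def by blast
    then show "z \<in> W" using sums_W[OF xy(1,2)] by simp
  qed
  \<comment> \<open>Factoring out all periods leaves none, so
    \<open>small_doubling_stabilizer\<close> applies to \<open>A\<close> with a stabilizer of size
    1; this is \<open>quad\<close>.\<close>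
  have stab: "stab S = {0}"
  proof
    show "stab S \<subseteq> {0}"
    proof
      fix c assume "c \<in> stab S"
      then have im: "(+) c ` S = S" by (simp add: stab_def)
      then have "c + 0 \<in> S" using zS by blast
      then obtain p where p: "c = residue g p" using Sform by auto
      have "z + p \<in> W \<longleftrightarrow> z \<in> W" for z
      proof -
        have "z + p \<in> W \<longleftrightarrow> c + residue g z \<in> S"
          unfolding W_iff p by (simp add: residue_add add.commute)
        also have "\<dots> \<longleftrightarrow> c + residue g z \<in> (+) c ` S" by (simp only: im)
        also have "\<dots> \<longleftrightarrow> residue g z \<in> S" by (auto simp: inj_image_mem_iff)
        finally show ?thesis by (simp add: W_iff)
      qed
      then have "p \<in> \<Pi>" by (simp add: \<Pi>_def)
      then have "g dvd p" using g(2) by blast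
      then show "c \<in> {0}" using p g(1) by (simp add: residue_eq_0_iff)
    qed
  qed (simp add: stab_def)
  let ?Y = "rdouble X"
  have finY: "finite ?Y" by (rule finite_rdouble[OF fin])
  have Srange: "S \<subseteq> range (residue g)" using Sform by blast
  have lift: "\<exists>y\<in>?Y. residue l y = residue l z \<and> residue g y = residue g z" if "residue g z \<in> S" for z
  proof -
    have "residue l z \<in> residue l ` ?Y"
      using that dP rdouble_residues by (auto simp: W_iff[symmetric] W_def)
    then obtain y where "y \<in> ?Y" "residue l y = residue l z" by force
    then show ?thesis using res_mono[of y z] by blast
  qed
  have cardU: "card {z \<in> {0..<l}. residue g z \<in> U} = card U * nat h" if "U \<subseteq> S" for U
    unfolding h by (rule card_residue_preimage)
      (use that g(1) h0 Srange finite_subset[OF that finS] in auto)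
  \<comment> \<open>The sumset modulo \<open>l\<close> is a union of full cosets, so each supplies
    \<open>h\<close> residues, all attained by sums of distinct elements of
    \<open>X\<close>.\<close>
  have cardR: "card U * nat h \<le> card (residue l ` {y \<in> ?Y. residue g y \<in> U})" if US: "U \<subseteq> S" for U
  proof -
    have "card (residue l ` {z \<in> {0..<l}. residue g z \<in> U}) \<le> card (residue l ` {y \<in> ?Y. residue g y \<in> U})"
    proof (intro card_mono image_subsetI)
      fix z assume z: "z \<in> {z \<in> {0..<l}. residue g z \<in> U}"
      then obtain y where "y \<in> ?Y" "residue l y = residue l z" "residue g y = residue g z"
        using lift[of z] US by blast
      then show "residue l z \<in> residue l ` {y \<in> ?Y. residue g y \<in> U}" using z by (intro image_eqI[of _ _ y]) auto
    qed (use finY in auto)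
    moreover have "card (residue l ` {z \<in> {0..<l}. residue g z \<in> U}) = card {z \<in> {0..<l}. residue g z \<in> U}"
      by (rule card_image, rule inj_on_subset[OF inj_on_residue[OF l]]) auto
    ultimately show ?thesis using cardU[OF US] by simp
  qed
  have resl: "residue g (x + l) = residue g x" for x
    using g(1) \<open>g dvd l\<close> by (simp add: residue_eq_iff)
  \<comment> \<open>The condition \<open>A \<subseteq> U\<close> keeps both \<open>x\<close> and
    \<open>x + l\<close> in the selected cosets, so the surplus \<open>m - 1\<close> survives when
    cosets outside \<open>A\<close> are dropped.\<close>
  have lowerU: "int (card U) * h + m - 1 \<le> int (card {y \<in> ?Y. residue g y \<in> U})"
    if "A \<subseteq> U" "U \<subseteq> S" for U
  proof -
    have "card (residue l ` {y \<in> ?Y. residue g y \<in> U}) + card X \<le> card {y \<in> ?Y. residue g y \<in> U} + 2"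
    proof (rule card_ge_residues)
      fix x assume x: "x \<in> X - {0, l}"
      then have "residue g x \<in> U" using that(1) by (auto simp: A_def)
      then show "x \<in> {y \<in> ?Y. residue g y \<in> U} \<and> x + l \<in> {y \<in> ?Y. residue g y \<in> U}"
        using rdouble_members[OF x] by (simp add: resl)
    qed (use finY in auto)
    then have "int (card U * nat h) + m - 1 \<le> int (card {y \<in> ?Y. residue g y \<in> U})"
      using cardR[OF that(2)] m by linarith
    then show ?thesis using h0 by simp
  qed
  define t where "t = int (card A)"
  define s where "s = int (card S)"
  have t1: "1 \<le> t" using zA finA by (auto simp: t_def Suc_le_eq card_gt_0_iff)
  have ts: "t \<le> s" using card_mono[OF finS AS] by (simp add: t_def s_def)
  \<comment> \<open>The other \<open>t - 1\<close> cosets hold at most \<open>h\<close> each of the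
    \<open>m\<close> elements of \<open>X - {l}\<close>.\<close>
  have class_ge: "m - (t - 1) * h \<le> int (card {x \<in> X. residue g x = i})" if "i \<in> A" for i
  proof -
    have "X - {l} \<subseteq> {x \<in> X. residue g x = i} \<union> {z \<in> {0..<l}. residue g z \<in> A - {i}}"
      using sub by (force simp: A_def)
    then have "card (X - {l}) \<le> card ({x \<in> X. residue g x = i} \<union> {z \<in> {0..<l}. residue g z \<in> A - {i}})"
      by (intro card_mono) (use fin in \<open>auto intro: finite_subset[of _ "{0..<l}"]\<close>)
    also have "\<dots> \<le> card {x \<in> X. residue g x = i} + card {z \<in> {0..<l}. residue g z \<in> A - {i}}"
      by (rule card_Un_le)
    also have "card {z \<in> {0..<l}. residue g z \<in> A - {i}} = card (A - {i}) * nat h"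
      by (rule cardU) (use AS in auto)
    finally have "int (card (X - {l})) \<le> int (card {x \<in> X. residue g x = i} + card (A - {i}) * nat h)"
      by (simp only: of_nat_le_iff)
    then have "int (card (X - {l})) \<le> int (card {x \<in> X. residue g x = i}) + int (card (A - {i})) * h"
      using h0 by simp
    moreover have "int (card (A - {i})) = t - 1"
      using card_Suc_Diff1[OF finA that] by (simp add: t_def)
    moreover have "int (card (X - {l})) = m" using card_Suc_Diff1[OF fin top] m by simp
    ultimately show ?thesis by simp
  qed
  have m_le: "m \<le> t * h"
  proof -
    have "card (X - {l}) \<le> card {z \<in> {0..<l}. residue g z \<in> A}"
      by (intro card_mono) (use sub in \<open>force simp: A_def intro: finite_subset[of _ "{0..<l}"]\<close>)+
    also have "\<dots> = card A * nat h" by (rule cardU[OF AS])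
    finally have "int (card (X - {l})) \<le> int (card A * nat h)" by (simp only: of_nat_le_iff)
    then show ?thesis using card_Suc_Diff1[OF fin top] m h0 by (simp add: t_def)
  qed
  \<comment> \<open>If \<open>X\<close> meets one coset only, then \<open>g\<close> divides all of
    \<open>X\<close>, and the gcd condition gives \<open>g = 1\<close>.\<close>
  have tl: "h = l" if "t = 1"
  proof -
    have "A = {0}" using that zA by (auto simp: t_def card_1_singleton_iff)
    then have "g dvd x" if "x \<in> X" for x
      using that g(1) by (auto simp: A_def residue_eq_0_iff[symmetric])
    then have "g dvd Gcd X" by (rule Gcd_greatest)
    then have "g = 1" using gcd1 g(1) by simp
    then show ?thesis using h by simp
  qed
  have "{y \<in> ?Y. residue g y \<in> S} \<subseteq> ?Y" by blast
  then have "card {y \<in> ?Y. residue g y \<in> S} \<le> card ?Y" by (rule card_mono[OF finY])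
  then have Ns: "s * h + m - 1 \<le> N" using lowerU[OF AS] N by (simp add: s_def)
  have quad: "t * t \<le> 2 * t - s + s * (s - t)" if "s * (s - t) < t * t"
    using small_doubling_stabilizer[of A t s] finA zA that stab
    by (auto simp: t_def s_def S_def)
  have last: "(s - 1) * h + m - 1 + 2 * (m - (t - 1) * h) - 3 \<le> N"
    if "s * (s - t) < t * t" "2 \<le> t"
  proof -
    have "\<not> S \<subseteq> A"
    proof
      assume "S \<subseteq> A"
      then have "s = t" using AS by (auto simp: t_def s_def)
      then have "t * t \<le> 1 * t" using quad[OF that(1)] by simp
      then show False using that(2) by (simp only: mult_le_cancel_right) auto
    qed
    \<comment> \<open>\<open>lowerU\<close> with \<open>S - {w}\<close> covers the other cosets. In
      the coset \<open>w\<close>, the integer sums from the classes \<open>i\<close> and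
      \<open>j\<close> number at least \<open>2 * (m - (t - 1) * h) - 3\<close>.\<close>
    then obtain w where w: "w \<in> S" "w \<notin> A" by blast
    then obtain i j where ij: "i \<in> A" "j \<in> A" "w = i + j" by (auto simp: S_def double_def)
    let ?Xi = "{x \<in> X. residue g x = i}" and ?Xj = "{x \<in> X. residue g x = j}"
    let ?Yw = "{y \<in> ?Y. residue g y = w}" and ?Yo = "{y \<in> ?Y. residue g y \<in> S - {w}}"
    have "card ?Xi + card ?Xj \<le> card {p + q | p q. p \<in> ?Xi \<and> q \<in> ?Xj \<and> p \<noteq> q} + 3"
      by (rule card_distinct_sums) (use fin ij in \<open>auto simp: A_def\<close>)
    also have "card {p + q | p q. p \<in> ?Xi \<and> q \<in> ?Xj \<and> p \<noteq> q} \<le> card ?Yw"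
      by (intro card_mono) (use finY ij in \<open>auto simp: residue_add intro: rdoubleI\<close>)
    finally have 1: "card ?Xi + card ?Xj \<le> card ?Yw + 3" by simp
    have "int (card (S - {w})) * h + m - 1 \<le> int (card ?Yo)"
      by (rule lowerU) (use AS w in auto)
    moreover have "int (card (S - {w})) = s - 1"
      using card_Suc_Diff1[OF finS w(1)] by (simp add: s_def)
    ultimately have 2: "(s - 1) * h + m - 1 \<le> int (card ?Yo)" by simp
    have "card ?Yw + card ?Yo = card (?Yw \<union> ?Yo)"
      by (rule card_Un_disjoint[symmetric]) (use finY in auto)
    also have "\<dots> \<le> card ?Y" by (intro card_mono finY) auto
    finally have "int (card ?Xi) + int (card ?Xj) + int (card ?Yo) \<le> N + 3" using 1 N by linarith
    then have "(m - (t - 1) * h) + (m - (t - 1) * h) + ((s - 1) * h + m - 1) \<le> N + 3"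
      using add_mono[OF add_mono[OF class_ge[OF ij(1)] class_ge[OF ij(2)]] 2] by (rule order_trans[rotated])
    then show ?thesis by (simp add: algebra_simps)
  qed
  have "1 \<le> h" using h0 by simp
  with t1 ts m_le tl Ns quad last show ?thesis by blast
qed

end

section \<open>Estimates with the golden ratio\<close>

lemma golden_ratio_sq: "golden_ratio * golden_ratio = golden_ratio + 1"
  by (simp add: golden_ratio_def field_simps)

lemma golden_ratio_bounds: "1618 / 1000 < golden_ratio" "golden_ratio < 16181 / 10000"
proof -
  have "2236 / 1000 < sqrt 5" by (rule real_less_rsqrt) (simp add: power2_eq_square)
  moreover have "sqrt 5 < 22362 / 10000" by (rule real_less_lsqrt) (simp_all add: power2_eq_square)
  ultimately show "1618 / 1000 < golden_ratio" "golden_ratio < 16181 / 10000" by (auto simp: golden_ratio_def)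
qed

text \<open>For positive \<open>x\<close> and \<open>y\<close> the sign of this form decides whether
  \<open>x < golden_ratio * y\<close>; for \<open>s\<close> and \<open>t\<close> its negativity is
  the small doubling condition \<open>s * (s - t) < t * t\<close>.\<close>

lemma golden_quadratic:
  "x * x - x * y - y * y = (x - golden_ratio * y) * (x + (golden_ratio - 1) * y)" for x y :: real
proof -
  have "(x - golden_ratio * y) * (x + (golden_ratio - 1) * y)
      = x * x - x * y - (golden_ratio * golden_ratio - golden_ratio) * (y * y)"
    by (simp add: algebra_simps)
  then show ?thesis by (simp add: golden_ratio_sq)
qed

text \<open>By \<open>q\<close> the form \<open>s * s - s * t - t * t\<close> is at least
  \<open>s - 2 * t\<close>; raising \<open>s\<close> by one half makes it nonnegative.\<close>

lemma near_golden_ratio: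
  fixes s t :: int
  assumes t: "2 \<le> t" "t \<le> s" and q: "t * t \<le> 2 * t - s + s * (s - t)"
  shows "2 * golden_ratio * real_of_int t \<le> 2 * real_of_int s + 1"
proof -
  \<comment> \<open>This is what \<open>q\<close> leaves to be shown for the form at
    \<open>2 * s + 1\<close> and \<open>2 * t\<close>.\<close>
  have "10 * t - 1 \<le> 8 * s"
  proof (rule ccontr)
    assume "\<not> ?thesis"
    then have c: "8 * s \<le> 10 * t - 2" by simp
    show False
    proof (cases "s = t")
      case True
      then have "t * t \<le> 1 * t" using q by simp
      then show False using t by (simp only: mult_le_cancel_right) auto
    next
      case False
      define v where "v = s * (s - t)"
      \<comment> \<open>By \<open>c\<close>, the second factor is at most
        \<open>(10 * t - 2) - 8 * t - 8 = 2 * t - 10\<close>.\<close>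
      have "8 * s * (8 * (s - t - 1)) \<le> (10 * t - 2) * (2 * t - 10)"
        using c False t by (intro mult_mono) auto
      also have "8 * s * (8 * (s - t - 1)) = 64 * v - 64 * s" by (simp add: v_def algebra_simps)
      also have "(10 * t - 2) * (2 * t - 10) = 20 * (t * t) - 104 * t + 20" by (simp add: algebra_simps)
      finally have "44 * (t * t) \<le> 24 * t + 20" using q unfolding v_def[symmetric] by linarith
      moreover have "2 * t \<le> t * t" using t by (intro mult_right_mono) auto
      ultimately show False using t by linarith
    qed
  qed
  then have "0 \<le> (2 * s + 1) * (2 * s + 1) - (2 * s + 1) * (2 * t) - (2 * t) * (2 * t)"
    using q by (simp add: algebra_simps)
  then have "0 \<le> real_of_int ((2 * s + 1) * (2 * s + 1) - (2 * s + 1) * (2 * t) - (2 * t) * (2 * t))"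
    by (simp only: of_int_0_le_iff)
  then have "0 \<le> (real_of_int (2 * s + 1) - golden_ratio * real_of_int (2 * t))
      * (real_of_int (2 * s + 1) + (golden_ratio - 1) * real_of_int (2 * t))"
    by (simp only: of_int_diff of_int_mult golden_quadratic)
  moreover have "0 < real_of_int (2 * s + 1) + (golden_ratio - 1) * real_of_int (2 * t)"
    using t golden_ratio_bounds by (intro add_pos_nonneg mult_nonneg_nonneg) auto
  ultimately have "0 \<le> real_of_int (2 * s + 1) - golden_ratio * real_of_int (2 * t)"
    by (simp add: zero_le_mult_iff)
  then show ?thesis by simp
qed

text \<open>Either \<open>b\<close> is at least \<open>(2 * m - 5) / 3\<close>, or the quadratic
  inequality makes it about \<open>m / sqrt 2\<close>; both slopes exceed
  \<open>golden_ratio - 1\<close>. At \<open>m = 4\<close> the value \<open>b = 1\<close> satisfies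
  the premise but not the conclusion.\<close>

lemma isolated_arith:
  fixes m b :: nat
  assumes m: "3 \<le> m" "m \<noteq> 4"
    and b: "3 * b + 5 < 2 * m \<Longrightarrow> m * m + 4 \<le> 2 * (b * b) + 3 * b + 4 * m"
  shows "golden_ratio * (real m + 1) - 3 \<le> real m + real b"
proof (rule ccontr)
  assume "\<not> ?thesis"
  then have "real b < (golden_ratio - 1) * real m + golden_ratio - 3" by (simp add: algebra_simps)
  also have "(golden_ratio - 1) * real m \<le> 6181 / 10000 * real m"
    using golden_ratio_bounds by (intro mult_right_mono) auto
  finally have b_lt: "real b < 6181 / 10000 * real m - 13819 / 10000" using golden_ratio_bounds by simp
  show False
  proof (cases "m \<le> 8")
    case True
    then have "m = 3 \<or> m = 5 \<or> m = 6 \<or> m = 7 \<or> m = 8" using m by linarith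
    moreover have False if "m = 3"
    proof -
      have "b \<le> 0" using b_lt that by simp
      then show False using b that by simp
    qed
    moreover have False if "m = 5"
    proof -
      have "b < 2" using b_lt that by simp
      then have "b = 0 \<or> b = 1" by linarith
      then show False using b that by auto
    qed
    moreover have False if "m = 6"
    proof -
      have "b < 3" using b_lt that by simp
      then have "b = 0 \<or> b = 1 \<or> b = 2" by linarith
      then show False using b that by auto
    qed
    moreover have False if "m = 7"
    proof -
      have "b < 3" using b_lt that by simp
      then have "b = 0 \<or> b = 1 \<or> b = 2" by linarith
      then show False using b that by auto
    qed
    moreover have False if "m = 8"
    proof -
      have "b < 4" using b_lt that by simp
      then have "b = 0 \<or> b = 1 \<or> b = 2 \<or> b = 3" by linarith
      then show False using b that by auto
    qed
    ultimately show False by blast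
  next
    case False
    then obtain e where e: "m = 9 + e" using le_Suc_ex[of 9 m] by auto
    have "real m = 9 + real e" using e by simp
    \<comment> \<open>At \<open>m = 9 + e\<close>, \<open>b_lt\<close> reads
      \<open>b < 4.181 + 0.6181 * e\<close>; both coefficients are rounded up.\<close>
    define \<beta> where "\<beta> = 21 / 5 + 31 / 50 * real e"
    have bb: "real b \<le> \<beta>" using b_lt \<open>real m = 9 + real e\<close> unfolding \<beta>_def by linarith
    then have "3 * real b + 5 < 2 * real m" using \<open>real m = 9 + real e\<close> unfolding \<beta>_def by linarith
    then have "3 * b + 5 < 2 * m" by linarith
    from b[OF this] have "real (m * m + 4) \<le> real (2 * (b * b) + 3 * b + 4 * m)"
      by (simp only: of_nat_le_iff)
    then have 1: "real m * real m + 4 \<le> 2 * (real b * real b) + 3 * real b + 4 * real m" by simp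
    have "real b * real b \<le> \<beta> * \<beta>"
      using bb by (intro mult_mono) auto
    also have "\<beta> * \<beta> = 441 / 25 + 651 / 125 * real e + 961 / 2500 * (real e * real e)"
      by (simp add: \<beta>_def field_simps)
    finally have 2: "real b * real b \<le> 441 / 25 + 651 / 125 * real e + 961 / 2500 * (real e * real e)" .
    have 3: "real m * real m = 81 + 18 * real e + real e * real e" using e by (simp add: algebra_simps)
    have "0 \<le> real e * real e" by simp
    with 1 2 3 bb show False using \<open>real m = 9 + real e\<close> unfolding \<beta>_def by linarith
  qed
qed

lemma (in normal_set) sparse_bound:
  assumes "Gcd X = 1" "4 \<le> card X" "card X \<noteq> 5" "2 * int (card X) - 4 \<le> l"
  shows "(golden_ratio + 1) * real (card X) - 6 \<le> real (card (rdouble X))"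
proof (cases "\<forall>d\<in>P. d + d \<in> rdouble P")
  case False
  then obtain d where d: "d \<in> P" "d + d \<notin> rdouble P" by blast
  obtain b where b: "card (rdouble P) + 1 = card P + b"
     "3 * b + 5 < 2 * card P \<Longrightarrow> card P * card P + 4 \<le> 2 * (b * b) + 3 * b + 4 * card P"
    using isolated_double_circle[OF _ d] fin by blast
  have 1: "golden_ratio * (real (card P) + 1) - 3 \<le> real (card P) + real b"
    by (rule isolated_arith) (use card_P assms b(2) in auto)
  have 2: "real (card P) + real b + real (card X) \<le> real (card (rdouble X)) + 3"
    using card_rdouble_ge b(1) by linarith
  have 3: "real (card X) = real (card P) + 1" using card_P by linarith
  show ?thesis using 1 2 unfolding 3 by (simp add: algebra_simps)
next
  case True
  define N where "N = int (card (rdouble X))"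
  define m where "m = int (card X) - 1"
  from periodic_bound[OF True assms(1) N_def m_def]
  obtain t s h where tsh: "1 \<le> h" "1 \<le> t" "t \<le> s" "m \<le> t * h" "t = 1 \<longrightarrow> h = l"
    "s * h + m - 1 \<le> N" "s * (s - t) < t * t \<longrightarrow> t * t \<le> 2 * t - s + s * (s - t)"
    "s * (s - t) < t * t \<and> 2 \<le> t \<longrightarrow> (s - 1) * h + m - 1 + 2 * (m - (t - 1) * h) - 3 \<le> N"
    by (elim exE conjE)
  let ?\<theta> = golden_ratio
  let ?m = "real_of_int m" and ?h = "real_of_int h" and ?s = "real_of_int s" and ?t = "real_of_int t"
  have m3: "3 \<le> m" using assms by (simp add: m_def)
  show ?thesis
  proof (rule ccontr)
    assume "\<not> ?thesis"
    then have N: "real_of_int N < ?\<theta> * ?m + ?m + ?\<theta> - 5" by (simp add: N_def m_def algebra_simps)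
    have i: "?s * ?h + ?m - 1 \<le> real_of_int N" using tsh(6) by (metis of_int_1 of_int_add of_int_diff of_int_le_iff of_int_mult)
    show False
    proof (cases "t = 1")
      case True
      then have "1 * l \<le> s * h" using tsh l by (intro mult_mono) auto
      then have "3 * m - 3 \<le> N" using tsh(6) assms(4) by (simp add: m_def)
      then have "3 * ?m - 3 \<le> real_of_int N" by linarith
      moreover have "?\<theta> * ?m \<le> 16181 / 10000 * ?m" using golden_ratio_bounds m3 by (intro mult_right_mono) auto
      ultimately show False using N golden_ratio_bounds m3 by linarith
    next
      case False
      then have t2: "2 \<le> t" using tsh(2) by simp
      have mth: "?m \<le> ?t * ?h" using tsh(4) by (metis of_int_le_iff of_int_mult)
      \<comment> \<open>The assumed failure of the bound puts the doubling \<open>s / t\<close>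
        below the golden ratio, which is the premise for the estimates of small doubling.\<close>
      have "?s * ?h < ?\<theta> * ?m" using i N golden_ratio_bounds by linarith
      also have "\<dots> \<le> ?\<theta> * (?t * ?h)" using mth golden_ratio_bounds by (intro mult_left_mono) auto
      finally have "?s * ?h < (?\<theta> * ?t) * ?h" by simp
      then have "?s < ?\<theta> * ?t" using tsh(1) by (simp add: mult_less_cancel_right)
      moreover have "0 < ?s + (?\<theta> - 1) * ?t"
        using tsh(2,3) golden_ratio_bounds by (intro add_pos_nonneg mult_nonneg_nonneg) auto
      ultimately have "?s * ?s - ?s * ?t - ?t * ?t < 0"
        unfolding golden_quadratic by (intro mult_neg_pos) auto
      then have "real_of_int (s * (s - t)) < real_of_int (t * t)" by (simp add: algebra_simps)
      then have st: "s * (s - t) < t * t" by (simp only: of_int_less_iff)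
      have "2 * ?\<theta> * ?t \<le> 2 * ?s + 1" by (rule near_golden_ratio[OF t2 tsh(3) tsh(7)[rule_format, OF st]])
      then have "(2 * ?\<theta> * ?t) * ?h \<le> (2 * ?s + 1) * ?h" using tsh(1) by (intro mult_right_mono) auto
      then have near: "2 * (?\<theta> * (?t * ?h)) \<le> 2 * (?s * ?h) + ?h" by (simp add: algebra_simps)
      have "real_of_int ((s - 1) * h + m - 1 + 2 * (m - (t - 1) * h) - 3) \<le> real_of_int N"
        using tsh(8) st t2 by (simp only: of_int_le_iff)
      then have ii: "?s * ?h + ?h + 3 * ?m - 4 - 2 * (?t * ?h) \<le> real_of_int N" by (simp add: algebra_simps)
      \<comment> \<open>The number of places in the \<open>t\<close> cosets left empty by
        \<open>X\<close> modulo \<open>l\<close>. Given \<open>near\<close>, failure of the bound in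
        \<open>i\<close> makes \<open>u\<close> less than about
        \<open>h / (2 * golden_ratio)\<close>, while \<open>ii\<close> makes
        \<open>(2 - golden_ratio) * u\<close> more than about \<open>h / 2\<close>.\<close>
      define u where "u = ?t * ?h - ?m"
      have u: "0 \<le> u" "?m = ?t * ?h - u" using mth by (auto simp: u_def)
      have \<theta>m: "?\<theta> * ?m = ?\<theta> * (?t * ?h) - ?\<theta> * u" unfolding u(2) by (simp add: algebra_simps)
      have \<theta>u: "1 * u \<le> ?\<theta> * u" using u golden_ratio_bounds by (intro mult_right_mono) auto
      show False using i ii N near \<theta>m \<theta>u u golden_ratio_bounds by linarith
    qed
  qed
qed

subsection \<open>Subset sums\<close>

text \<open>Settles the size that \<open>isolated_arith\<close> leaves out. The sums involving 0 or
  \<open>l\<close> are seven; if there are no others, then \<open>a + b\<close>,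
  \<open>a + c\<close> and \<open>b + c\<close> are among them, which forces
  \<open>b = 2 * a\<close>, \<open>c = 3 * a\<close>, \<open>l = 4 * a\<close>, and
  \<open>a = 1\<close> by the gcd condition.\<close>

lemma four_element_bound:
  fixes a b c l :: int
  assumes ord: "0 < a" "a < b" "b < c" "c < l" and gcd1: "Gcd {a, b, c, l} = 1" and l: "6 \<le> l"
  shows "8 \<le> card (rdouble {0, a, b, c, l})"
proof (rule ccontr)
  assume "\<not> ?thesis"
  then have less: "card (rdouble {0, a, b, c, l}) \<le> 7" by simp
  let ?L = "{a, b, c, l, a + l, b + l, c + l}"
  have mem: "x + y \<in> rdouble {0, a, b, c, l}" if "x \<in> {0, a, b, c, l}" "y \<in> {0, a, b, c, l}" "x \<noteq> y" for x y
    by (rule rdoubleI[OF that])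
  have "?L \<subseteq> rdouble {0, a, b, c, l}"
    using mem[of 0 a] mem[of 0 b] mem[of 0 c] mem[of 0 l] mem[of a l] mem[of b l] mem[of c l] ord by simp
  moreover have "card ?L = 7" using ord by simp
  ultimately have L: "rdouble {0, a, b, c, l} = ?L"
    using less by (intro card_seteq[symmetric] finite_rdouble) auto
  have "a + b \<in> ?L" "a + c \<in> ?L" "b + c \<in> ?L"
    unfolding L[symmetric] using mem[of a b] mem[of a c] mem[of b c] ord by auto
  then have ac: "a + c = l" and bc: "b + c = a + l" and ab: "a + b = c \<or> a + b = l"
    using ord by auto
  have "b = 2 * a" "c = 3 * a" "l = 4 * a" using ac bc ab ord by linarith+
  then have "a dvd Gcd {a, b, c, l}" by (intro Gcd_greatest) auto
  then have "a = 1" using gcd1 ord by simp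
  then show False using \<open>l = 4 * a\<close> l by simp
qed

lemma subset_sums_ge_eq_image:
  "subset_sums_ge \<alpha> A = \<Sum> ` {B. B \<subseteq> A \<and> \<alpha> \<le> card B}"
  unfolding subset_sums_ge_def by auto

lemma finite_subset_sums_ge: "finite A \<Longrightarrow> finite (subset_sums_ge \<alpha> A)"
  unfolding subset_sums_ge_eq_image by simp

lemma card_subset_sums_ge_step:
  assumes fin: "finite A" and pos: "\<forall>x\<in>A. 0 < x" and r: "r + 1 \<le> card A"
  shows "card (subset_sums_ge (r + 1) A) + r + 1 \<le> card (subset_sums_ge r A)"
proof -
  let ?S = "subset_sums_ge (r + 1) A"
  have finS: "finite ?S" by (rule finite_subset_sums_ge[OF fin])
  have "\<Sum>A \<in> ?S" using r by (auto simp: subset_sums_ge_def)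
  then have "Min ?S \<in> ?S" using finS by (intro Min_in) auto
  then obtain B where B: "B \<subseteq> A" "r + 1 \<le> card B" "Min ?S = \<Sum>B" by (auto simp: subset_sums_ge_def)
  have finB: "finite B" using B fin finite_subset by blast
  let ?N = "(\<lambda>b. \<Sum>B - b) ` B"
  have "?N \<subseteq> subset_sums_ge r A"
  proof (intro image_subsetI)
    fix b assume b: "b \<in> B"
    have "\<Sum>B - b = \<Sum>(B - {b})" using finB b by (simp add: sum_diff1)
    moreover have "r \<le> card (B - {b})" using B(2) finB b by simp
    ultimately show "\<Sum>B - b \<in> subset_sums_ge r A"
      using B(1) unfolding subset_sums_ge_def by blast
  qed
  moreover have "?S \<subseteq> subset_sums_ge r A" by (auto simp: subset_sums_ge_def)
  ultimately have "card (?S \<union> ?N) \<le> card (subset_sums_ge r A)"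
    by (intro card_mono finite_subset_sums_ge fin) auto
  \<comment> \<open>As all elements are positive, the new sums lie strictly below the minimum of the
    old ones.\<close>
  moreover have "card (?S \<union> ?N) = card ?S + card ?N"
  proof (rule card_Un_disjoint)
    show "?S \<inter> ?N = {}"
    proof (rule ccontr)
      assume "\<not> ?thesis"
      then obtain b where b: "b \<in> B" "\<Sum>B - b \<in> ?S" by auto
      then have "\<Sum>B \<le> \<Sum>B - b" using Min_le[OF finS b(2)] B(3) by simp
      then show False using pos b(1) B(1) by force
    qed
  qed (use finS finB in auto)
  moreover have "card ?N = card B" by (rule card_image) (auto simp: inj_on_def)
  ultimately show ?thesis using B(2) by linarith
qed

text \<open>The increments \<open>r + 1\<close> telescope to a difference of triangular numbers;
  doubling avoids division.\<close>

lemma card_subset_sums_ge_iterate: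
  assumes fin: "finite A" and pos: "\<forall>x\<in>A. 0 < x" and "r \<le> q" "q \<le> card A"
  shows "2 * card (subset_sums_ge q A) + q * (q + 1)
    \<le> 2 * card (subset_sums_ge r A) + r * (r + 1)"
  using \<open>r \<le> q\<close> \<open>q \<le> card A\<close>
proof (induction q rule: dec_induct)
  case (step q)
  then show ?case using card_subset_sums_ge_step[OF fin pos, of q] by simp
qed simp

lemma card_subset_sums_ge_base:
  assumes fin: "finite A" and pos: "\<forall>x\<in>A. 0 < x"
  shows "card (rdouble (insert 0 A)) + 1 \<le> card (subset_sums_ge (card A - 2) A)"
proof -
  let ?X = "insert 0 A" and ?f = "\<lambda>y. \<Sum>A - y"
  have "0 \<notin> rdouble ?X"
  proof
    assume "0 \<in> rdouble ?X"
    then obtain u v where uv: "u \<in> ?X" "v \<in> ?X" "u \<noteq> v" "u + v = 0" by (auto simp: rdouble_def)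
    then have "0 \<le> u" "0 \<le> v" using pos by (auto intro: less_imp_le)
    then show False using uv by linarith
  qed
  then have "card (rdouble ?X) + 1 = card (insert 0 (rdouble ?X))"
    using fin finite_rdouble[of ?X] by simp
  also have "\<dots> = card (?f ` insert 0 (rdouble ?X))"
    by (rule card_image[symmetric]) (auto simp: inj_on_def)
  also have "\<dots> \<le> card (subset_sums_ge (card A - 2) A)"
  proof (intro card_mono finite_subset_sums_ge fin image_subsetI)
    fix y assume y: "y \<in> insert 0 (rdouble ?X)"
    have "\<exists>D\<subseteq>A. card D \<le> 2 \<and> \<Sum>D = y"
    proof (cases "y = 0")
      case True
      then show ?thesis by (intro exI[of _ "{}"]) auto
    next
      case False
      then obtain u v where uv: "u \<in> ?X" "v \<in> ?X" "u \<noteq> v" "y = u + v"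
        using y by (auto simp: rdouble_def)
      \<comment> \<open>If one summand is 0, only a single element of \<open>A\<close> is
        removed.\<close>
      have "\<Sum>({u, v} - {0}) = y" using uv by (auto simp: insert_Diff_if)
      moreover have "card ({u, v} - {0}) \<le> card {u, v}" by (intro card_mono) auto
      moreover have "card {u, v} = 2" using uv by simp
      ultimately show ?thesis using uv(1,2) by (intro exI[of _ "{u, v} - {0}"]) auto
    qed
    then obtain D where D: "D \<subseteq> A" "card D \<le> 2" "\<Sum>D = y" by blast
    have "\<Sum>(A - D) = \<Sum>A - y" using D fin by (simp add: sum_diff)
    moreover have "card A - 2 \<le> card (A - D)"
      using D fin card_Diff_subset[of D A] finite_subset[OF D(1) fin] by simp
    ultimately show "\<Sum>A - y \<in> subset_sums_ge (card A - 2) A"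
      unfolding subset_sums_ge_def by (intro CollectI exI[of _ "A - D"]) auto
  qed
  finally show ?thesis .
qed

theorem theorem5p1:
  fixes k \<alpha> :: nat and a :: "nat \<Rightarrow> int" and A :: "int set"
  assumes "k \<ge> 3"
    and "A = a ` {1..k}"
    and "\<forall>i\<in>{1..k}. a i > 0"
    and "strict_mono_on {1..k} a"
    and "Gcd A = 1"
    and "1 \<le> \<alpha>" and "\<alpha> \<le> k - 2"
  shows "(a k \<le> 2 * int k - 3 \<longrightarrow>
           real (card (subset_sums_ge \<alpha> A)) \<ge>
             real_of_int (a k) + real k * (real k - 1) / 2 - real \<alpha> * (real \<alpha> + 1) / 2 + 1) \<and>
         (a k \<ge> 2 * int k - 2 \<longrightarrow>
           real (card (subset_sums_ge \<alpha> A)) \<ge>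
             golden_ratio * (real k + 1) - 4 + real k * (real k - 1) / 2 - real \<alpha> * (real \<alpha> + 1) / 2 + 1)"
proof -
  have finA: "finite A" and pos: "\<forall>x\<in>A. 0 < x" using assms(2,3) by auto
  have inj: "inj_on a {1..k}" using assms(4) by (rule strict_mono_on_imp_inj_on)
  then have cA: "card A = k" using assms(2) by (simp add: card_image)
  let ?X = "insert 0 A"
  have "0 \<notin> A" using pos by blast
  then have cX: "card ?X = k + 1" using finA cA by simp
  have akA: "a k \<in> A" using assms(1,2) by auto
  interpret normal_set ?X "a k"
  proof
    have "a i \<le> a k" if "i \<in> {1..k}" for i
      using strict_mono_onD[OF assms(4), of i k] that by (cases "i = k") auto
    then show "?X \<subseteq> {0..a k}" using pos bspec[OF pos akA] assms(2) by (force intro: less_imp_le)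
    show "0 < a k" by (rule bspec[OF pos akA])
  qed (use finA akA in auto)
  have gX: "Gcd ?X = 1" using assms(5) by simp
  define N where "N = real (card (rdouble ?X))"
  have le: "N + 1 + (real k - 2) * (real k - 1) / 2 - real \<alpha> * (real \<alpha> + 1) / 2
      \<le> real (card (subset_sums_ge \<alpha> A))"
  proof -
    have "2 * card (subset_sums_ge (k - 2) A) + (k - 2) * (k - 2 + 1)
      \<le> 2 * card (subset_sums_ge \<alpha> A) + \<alpha> * (\<alpha> + 1)"
      by (rule card_subset_sums_ge_iterate[OF finA pos]) (use assms cA in auto)
    then have "real (2 * card (subset_sums_ge (k - 2) A) + (k - 2) * (k - 2 + 1))
      \<le> real (2 * card (subset_sums_ge \<alpha> A) + \<alpha> * (\<alpha> + 1))" by (simp only: of_nat_le_iff)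
    moreover have "real (k - 2) = real k - 2" using assms(1) by simp
    moreover have "N + 1 \<le> real (card (subset_sums_ge (k - 2) A))"
      using card_subset_sums_ge_base[OF finA pos] cA unfolding N_def by simp
    ultimately show ?thesis by (simp add: field_simps)
  qed
  \<comment> \<open>Both bounds on \<open>N\<close> contain a summand \<open>k - 1\<close>, which
    turns \<open>(k - 2) * (k - 1) / 2\<close> in \<open>le\<close> into
    \<open>k * (k - 1) / 2\<close>.\<close>
  have "real_of_int (a k) + real k - 1 \<le> N" if "a k \<le> 2 * int k - 3"
  proof -
    have "a k + int (k + 1) \<le> int (card (rdouble ?X)) + 2"
      using dense_bound that cX by simp
    then show ?thesis unfolding N_def by linarith
  qed
  moreover have "(golden_ratio + 1) * (real k + 1) - 6 \<le> N" if ak: "a k \<ge> 2 * int k - 2"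
  proof (cases "k = 4")
    case True
    then have "{1..k} = {1, 2, 3, 4}" by auto
    then have A: "A = {a 1, a 2, a 3, a 4}" using assms(2) by simp
    have "8 \<le> card (rdouble {0, a 1, a 2, a 3, a 4})"
    proof (rule four_element_bound)
      show "0 < a 1" using assms(3) True by auto
      show "a 1 < a 2" "a 2 < a 3" "a 3 < a 4"
        using True by (auto intro!: strict_mono_onD[OF assms(4)])
      show "Gcd {a 1, a 2, a 3, a 4} = 1" using assms(5) A by simp
      show "6 \<le> a 4" using ak True by simp
    qed
    then have "8 \<le> N" unfolding N_def A by simp
    then show ?thesis using golden_ratio_bounds True by simp
  next
    case False
    then show ?thesis using sparse_bound[OF gX] assms(1) ak cX unfolding N_def by (simp add: add.commute)
  qed
  ultimately show ?thesis using le by (auto simp: field_simps)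
qed

end
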